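(* Let $\chi_\Gamma(q)$ denote the chromatic polynomial of a graph $\Gamma$. Then $$\sum_{l(\lambda)\ge2}\chi_{\mathsf K_\lambda}(q)\frac{m_\lambda}{\lambda!}+\sum_{n\ge1,\ |\lambda|\ge0}\chi_{\mathsf K_{(1^n)\cup\lambda}}(q)\frac{m_\lambda}{\lambda!}\cdot\frac{z^n}{n!}=\Bigl(1+z+\sum_{n\ge1}\frac{p_n}{n!}\Bigr)^q-1-\sum_{n\ge1}\frac{p_nq^n}{n!}.$$ In particular, $$\sum_{\lambda}\chi_{\mathsf K_\lambda}(q)\frac{m_\lambda}{\lambda!}=\Bigl(1+\sum_{n\ge1}\frac{p_n}{n!}\Bigr)^q,$$ where the sum is over all integer partitions $\lambda$, including the empty one, with the convention $\chi_{\mathsf K_{(0)}}(q)=1$ for the empty graph.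
   Context: For an integer partition $\lambda=(\lambda_1\ge\dots\ge\lambda_k)$, $|\lambda|=\sum\lambda_i$, $l(\lambda)$ is the number of non-zero parts, $\lambda!=\prod\lambda_i!$, and $\mathsf K_\lambda$ is the complete multipartite graph with independent blocks of sizes $\lambda_1,\dots,\lambda_k$ (two vertices adjacent iff in different blocks; $\mathsf K_{(n)}$ is $n$ isolated vertices). $(1^n)\cup\lambda$ is $\lambda$ with $n$ additional parts equal to $1$. $m_\lambda$ is the monomial symmetric function and $p_n=\sum_{i\ge1}x_i^n$ the power sum in $x_1,x_2,\dots$. Identities are of formal power series in $z$ and $x_i$ with coefficients in $\mathbb Q[q]$, with $(1+u)^q=\sum_j\binom qju^j$. *)

theory Defs
  imports
    "HOL-Analysis.Infinite_Sum"
    "HOL-Library.Poly_Mapping"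
    "HOL-Library.Multiset"
    "HOL-Library.FuncSet"
    "HOL-Computational_Algebra.Polynomial"
begin

section \<open>Formal power series in arbitrarily many variables\<close>

text \<open>A monomial is a finitely supported exponent vector; a power series assigns a coefficient to
  every monomial.  No finiteness is imposed on the set of variables or on the support.\<close>

typedef ('v, 'a) mps = "UNIV :: (('v \<Rightarrow>\<^sub>0 nat) \<Rightarrow> 'a) set"
  morphisms mps_coeff Abs_mps
  by simp

lemma mps_coeff_Abs [simp]: "mps_coeff (Abs_mps f) = f"
  by (simp add: Abs_mps_inverse)

lemma mps_eqI: "(\<And>m. mps_coeff f m = mps_coeff g m) \<Longrightarrow> f = g"
  by (metis mps_coeff_inject ext)

lemma mps_eq_iff: "f = g \<longleftrightarrow> (\<forall>m. mps_coeff f m = mps_coeff g m)"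
  using mps_eqI by auto

definition monomial_splits :: "('v \<Rightarrow>\<^sub>0 nat) \<Rightarrow> (('v \<Rightarrow>\<^sub>0 nat) \<times> ('v \<Rightarrow>\<^sub>0 nat)) set" where
  "monomial_splits m = {(a, b). a + b = m}"

lemma finite_monomial_splits [simp]: "finite (monomial_splits m)"
proof -
  let ?K = "Poly_Mapping.keys m"
  let ?D = "PiE ?K (\<lambda>v. {..Poly_Mapping.lookup m v})"
  let ?r = "\<lambda>(a, b). (restrict (Poly_Mapping.lookup a) ?K, restrict (Poly_Mapping.lookup b) ?K)"
  have fin: "finite (?D \<times> ?D)"
    by (intro finite_cartesian_product finite_PiE) auto
  have zero: "Poly_Mapping.lookup a v = 0 \<and> Poly_Mapping.lookup b v = 0" if "a + b = m" "v \<notin> ?K" for a b v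
    using that by (metis add_is_0 in_keys_iff lookup_add)
  have "?r ` monomial_splits m \<subseteq> ?D \<times> ?D"
    by (auto simp: monomial_splits_def lookup_add)
  then have "finite (?r ` monomial_splits m)"
    using fin finite_subset by blast
  moreover have "inj_on ?r (monomial_splits m)"
  proof (rule inj_onI, clarify)
    fix a b c d
    assume *: "(a, b) \<in> monomial_splits m" "(c, d) \<in> monomial_splits m"
      and r: "restrict (Poly_Mapping.lookup a) ?K = restrict (Poly_Mapping.lookup c) ?K"
        "restrict (Poly_Mapping.lookup b) ?K = restrict (Poly_Mapping.lookup d) ?K"
    have "Poly_Mapping.lookup a v = Poly_Mapping.lookup c v \<and> Poly_Mapping.lookup b v = Poly_Mapping.lookup d v" for v
    proof (cases "v \<in> ?K")
      case True
      then show ?thesis using r by (metis restrict_apply')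
    next
      case False
      then show ?thesis using * zero[of a b v] zero[of c d v]
        by (simp add: monomial_splits_def)
    qed
    then show "a = c \<and> b = d"
      by (auto intro: poly_mapping_eqI)
  qed
  ultimately show ?thesis
    by (rule finite_imageD)
qed

lemma monomial_splits_0 [simp]: "monomial_splits 0 = {(0, 0)}"
proof -
  have "a = 0 \<and> b = 0" if "a + b = 0" for a b :: "'v \<Rightarrow>\<^sub>0 nat"
  proof -
    have "Poly_Mapping.lookup a v = 0 \<and> Poly_Mapping.lookup b v = 0" for v
      using that by (metis add_is_0 lookup_add lookup_zero)
    then show ?thesis
      by (auto intro: poly_mapping_eqI)
  qed
  then show ?thesis
    by (auto simp: monomial_splits_def)
qed

instantiation mps :: (type, zero) zero
begin
definition "0 = Abs_mps (\<lambda>_. 0)"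
instance ..
end

instantiation mps :: (type, "{zero, one}") one
begin
definition "1 = Abs_mps (\<lambda>m. if m = 0 then 1 else 0)"
instance ..
end

instantiation mps :: (type, plus) plus
begin
definition "f + g = Abs_mps (\<lambda>m. mps_coeff f m + mps_coeff g m)"
instance ..
end

instantiation mps :: (type, minus) minus
begin
definition "f - g = Abs_mps (\<lambda>m. mps_coeff f m - mps_coeff g m)"
instance ..
end

instantiation mps :: (type, uminus) uminus
begin
definition "- f = Abs_mps (\<lambda>m. - mps_coeff f m)"
instance ..
end

instantiation mps :: (type, "{comm_monoid_add, times}") times
begin
definition "f * g = Abs_mps (\<lambda>m. \<Sum>(a, b)\<in>monomial_splits m. mps_coeff f a * mps_coeff g b)"
instance ..
end

lemma mps_coeff_0 [simp]: "mps_coeff 0 m = 0"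
  by (simp add: zero_mps_def)

lemma mps_coeff_1: "mps_coeff 1 m = (if m = 0 then 1 else 0)"
  by (simp add: one_mps_def)

lemma mps_coeff_add [simp]: "mps_coeff (f + g) m = mps_coeff f m + mps_coeff g m"
  by (simp add: plus_mps_def)

lemma mps_coeff_diff [simp]: "mps_coeff (f - g) m = mps_coeff f m - mps_coeff g m"
  by (simp add: minus_mps_def)

lemma mps_coeff_uminus [simp]: "mps_coeff (- f) m = - mps_coeff f m"
  by (simp add: uminus_mps_def)

lemma mps_coeff_mult:
  "mps_coeff (f * g) m = (\<Sum>(a, b)\<in>monomial_splits m. mps_coeff f a * mps_coeff g b)"
  by (simp add: times_mps_def)

instance mps :: (type, comm_monoid_add) comm_monoid_add
  by standard (auto intro!: mps_eqI simp: add_ac)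

instance mps :: (type, comm_ring_1) comm_ring_1
proof
  fix f g h :: "('a, 'b) mps"
  show "f * g = g * f"
    by (intro mps_eqI, unfold mps_coeff_mult,
        rule sum.reindex_bij_witness[of _ prod.swap prod.swap])
       (auto simp: monomial_splits_def add.commute mult.commute)
  show "f * g * h = f * (g * h)"
  proof (rule mps_eqI)
    fix m :: "'a \<Rightarrow>\<^sub>0 nat"
    let ?F = "mps_coeff f" and ?G = "mps_coeff g" and ?H = "mps_coeff h"
    have "mps_coeff (f * g * h) m =
        (\<Sum>p\<in>monomial_splits m. \<Sum>q\<in>monomial_splits (fst p).
          ?F (fst q) * ?G (snd q) * ?H (snd p))"
      by (simp add: mps_coeff_mult case_prod_unfold sum_distrib_right)
    also have "\<dots> = (\<Sum>(p, q)\<in>Sigma (monomial_splits m) (\<lambda>p. monomial_splits (fst p)).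
        ?F (fst q) * ?G (snd q) * ?H (snd p))"
      by (subst sum.Sigma) auto
    also have "\<dots> = (\<Sum>(p, q)\<in>Sigma (monomial_splits m) (\<lambda>p. monomial_splits (snd p)).
        ?F (fst p) * (?G (fst q) * ?H (snd q)))"
      by (rule sum.reindex_bij_witness[of _
            "\<lambda>(p, q). ((fst p + fst q, snd q), (fst p, fst q))"
            "\<lambda>(p, q). ((fst q, snd q + snd p), (snd q, snd p))"])
         (auto simp: monomial_splits_def add.assoc mult.assoc)
    also have "\<dots> = (\<Sum>p\<in>monomial_splits m. \<Sum>q\<in>monomial_splits (snd p).
        ?F (fst p) * (?G (fst q) * ?H (snd q)))"
      by (subst sum.Sigma) auto
    also have "\<dots> = mps_coeff (f * (g * h)) m"
      by (simp add: mps_coeff_mult case_prod_unfold sum_distrib_left)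
    finally show "mps_coeff (f * g * h) m = mps_coeff (f * (g * h)) m" .
  qed
  show "1 * f = f"
  proof (rule mps_eqI)
    fix m :: "'a \<Rightarrow>\<^sub>0 nat"
    have "mps_coeff (1 * f) m =
        (\<Sum>p\<in>monomial_splits m. if p = (0, m) then mps_coeff f m else 0)"
      unfolding mps_coeff_mult
      by (intro sum.cong) (auto simp: mps_coeff_1 monomial_splits_def split: if_splits)
    also have "\<dots> = mps_coeff f m"
      by (simp add: sum.delta) (simp add: monomial_splits_def)
    finally show "mps_coeff (1 * f) m = mps_coeff f m" .
  qed
  show "(f + g) * h = f * h + g * h"
    by (intro mps_eqI)
       (simp add: mps_coeff_mult case_prod_unfold distrib_right sum.distrib)
  show "(0 :: ('a, 'b) mps) \<noteq> 1"
    by (auto simp: mps_eq_iff mps_coeff_1)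
qed (auto intro!: mps_eqI simp: algebra_simps)

definition mps_const :: "'a::zero \<Rightarrow> ('v, 'a) mps" where
  "mps_const c = Abs_mps (\<lambda>m. if m = 0 then c else 0)"

definition mps_var :: "'v \<Rightarrow> ('v, 'a::{zero, one}) mps" where
  "mps_var v = Abs_mps (\<lambda>m. if m = Poly_Mapping.single v 1 then 1 else 0)"

subsection \<open>Convergence\<close>

text \<open>The product topology with discrete coefficients.  By \<open>has_sum_mps_iff\<close> below, the generic
  notion of infinite sum then is the usual one for formal power series: each coefficient receives
  only finitely many nonzero contributions, and these are added up.\<close>

instantiation mps :: (type, type) topological_space
begin
definition "open (S :: ('a, 'b) mps set) \<longleftrightarrow>
  (\<forall>f\<in>S. \<exists>M. finite M \<and> {g. \<forall>m\<in>M. mps_coeff g m = mps_coeff f m} \<subseteq> S)"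
instance
proof
  show "open (UNIV :: ('a, 'b) mps set)"
    by (auto simp: open_mps_def)
next
  fix S T :: "('a, 'b) mps set"
  assume S: "open S" and T: "open T"
  show "open (S \<inter> T)"
    unfolding open_mps_def
  proof
    fix f assume f: "f \<in> S \<inter> T"
    obtain M where M: "finite M" "{g. \<forall>m\<in>M. mps_coeff g m = mps_coeff f m} \<subseteq> S"
      using f S by (auto simp: open_mps_def)
    obtain N where N: "finite N" "{g. \<forall>m\<in>N. mps_coeff g m = mps_coeff f m} \<subseteq> T"
      using f T by (auto simp: open_mps_def)
    show "\<exists>M. finite M \<and> {g. \<forall>m\<in>M. mps_coeff g m = mps_coeff f m} \<subseteq> S \<inter> T"
      using M N by (intro exI[of _ "M \<union> N"]) auto
  qed
next
  fix K :: "('a, 'b) mps set set"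
  assume K: "\<forall>S\<in>K. open S"
  show "open (\<Union>K)"
    unfolding open_mps_def
  proof
    fix f assume "f \<in> \<Union>K"
    then obtain S where S: "S \<in> K" "f \<in> S" by blast
    then obtain M where "finite M" "{g. \<forall>m\<in>M. mps_coeff g m = mps_coeff f m} \<subseteq> S"
      using K unfolding open_mps_def by meson
    then show "\<exists>M. finite M \<and> {g. \<forall>m\<in>M. mps_coeff g m = mps_coeff f m} \<subseteq> \<Union>K"
      using S by blast
  qed
qed
end

lemma open_mps_coeff_eq: "open {g. mps_coeff g m = c}"
  by (auto simp: open_mps_def intro!: exI[of _ "{m}"])

instance mps :: (type, type) t2_space
proof
  fix f g :: "('a, 'b) mps"
  assume "f \<noteq> g"
  then obtain m where "mps_coeff f m \<noteq> mps_coeff g m"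
    by (auto simp: mps_eq_iff)
  then show "\<exists>U V. open U \<and> open V \<and> f \<in> U \<and> g \<in> V \<and> U \<inter> V = {}"
    by (intro exI[of _ "{h. mps_coeff h m = mps_coeff f m}"]
        exI[of _ "{h. mps_coeff h m = mps_coeff g m}"]) (auto simp: open_mps_coeff_eq)
qed

lemma tendsto_mps_iff:
  "(f \<longlongrightarrow> l) F \<longleftrightarrow> (\<forall>m. eventually (\<lambda>x. mps_coeff (f x) m = mps_coeff l m) F)"
proof
  assume "(f \<longlongrightarrow> l) F"
  then show "\<forall>m. eventually (\<lambda>x. mps_coeff (f x) m = mps_coeff l m) F"
    using topological_tendstoD[OF _ open_mps_coeff_eq] by fastforce
next
  assume *: "\<forall>m. eventually (\<lambda>x. mps_coeff (f x) m = mps_coeff l m) F"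
  show "(f \<longlongrightarrow> l) F"
  proof (rule topological_tendstoI)
    fix S assume "open S" "l \<in> S"
    then obtain M where M: "finite M" "{g. \<forall>m\<in>M. mps_coeff g m = mps_coeff l m} \<subseteq> S"
      by (auto simp: open_mps_def)
    have "eventually (\<lambda>x. \<forall>m\<in>M. mps_coeff (f x) m = mps_coeff l m) F"
      using M(1) * by (simp add: eventually_ball_finite)
    then show "eventually (\<lambda>x. f x \<in> S) F"
      by eventually_elim (use M(2) in auto)
  qed
qed

instance mps :: (type, comm_monoid_add) topological_comm_monoid_add
proof
  fix f g :: "('a, 'b) mps"
  have ev: "\<forall>\<^sub>F x in nhds h. mps_coeff x m = mps_coeff h m" for h :: "('a, 'b) mps" and m
    by (rule eventually_nhds_in_open[OF open_mps_coeff_eq, simplified]) simp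
  have "\<forall>\<^sub>F x in nhds f \<times>\<^sub>F nhds g. mps_coeff (fst x + snd x) m = mps_coeff (f + g) m" for m
    unfolding eventually_prod_filter using ev[of m f] ev[of m g] by force
  then show "((\<lambda>x. fst x + snd x) \<longlongrightarrow> f + g) (nhds f \<times>\<^sub>F nhds g)"
    by (simp add: tendsto_mps_iff)
qed

lemma mps_coeff_sum: "mps_coeff (\<Sum>a\<in>A. f a) m = (\<Sum>a\<in>A. mps_coeff (f a) m)"
  by (induction A rule: infinite_finite_induct) auto

theorem has_sum_mps_iff:
  fixes f :: "'b \<Rightarrow> ('v, 'a::cancel_comm_monoid_add) mps"
  shows "(f has_sum s) A \<longleftrightarrow>
    (\<forall>m. finite {a\<in>A. mps_coeff (f a) m \<noteq> 0} \<and>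
         mps_coeff s m = (\<Sum>a\<in>{a\<in>A. mps_coeff (f a) m \<noteq> 0}. mps_coeff (f a) m))"
proof -
  have "(\<forall>\<^sub>F F in finite_subsets_at_top A. mps_coeff (sum f F) m = mps_coeff s m) \<longleftrightarrow>
    finite {a\<in>A. mps_coeff (f a) m \<noteq> 0} \<and>
    mps_coeff s m = (\<Sum>a\<in>{a\<in>A. mps_coeff (f a) m \<noteq> 0}. mps_coeff (f a) m)"
    (is "?ev \<longleftrightarrow> finite ?N \<and> ?eq") for m
  proof
    assume ?ev
    then obtain X where X: "finite X" "X \<subseteq> A"
      "\<And>Y. finite Y \<Longrightarrow> X \<subseteq> Y \<Longrightarrow> Y \<subseteq> A \<Longrightarrow> (\<Sum>a\<in>Y. mps_coeff (f a) m) = mps_coeff s m"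
      unfolding eventually_finite_subsets_at_top by (auto simp: mps_coeff_sum)
    have "?N \<subseteq> X"
    proof
      fix a assume a: "a \<in> ?N"
      show "a \<in> X"
      proof (rule ccontr)
        assume "a \<notin> X"
        then have "mps_coeff (f a) m + (\<Sum>a\<in>X. mps_coeff (f a) m) = (\<Sum>a\<in>X. mps_coeff (f a) m)"
          using X(3)[of "insert a X"] X(3)[of X] X(1,2) a by auto
        then show False using a by simp
      qed
    qed
    moreover have "(\<Sum>a\<in>X. mps_coeff (f a) m) = (\<Sum>a\<in>?N. mps_coeff (f a) m)"
      using X(1,2) \<open>?N \<subseteq> X\<close> by (intro sum.mono_neutral_right) auto
    ultimately show "finite ?N \<and> ?eq"
      using X(1) X(3)[of X] X(2) finite_subset by auto
  next
    assume N: "finite ?N \<and> ?eq"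
    have "(\<Sum>a\<in>Y. mps_coeff (f a) m) = mps_coeff s m" if "finite Y" "?N \<subseteq> Y" "Y \<subseteq> A" for Y
    proof -
      have "(\<Sum>a\<in>Y. mps_coeff (f a) m) = (\<Sum>a\<in>?N. mps_coeff (f a) m)"
        using that by (intro sum.mono_neutral_right) auto
      then show ?thesis using N by simp
    qed
    then have "finite ?N \<and> ?N \<subseteq> A \<and> (\<forall>Y. finite Y \<and> ?N \<subseteq> Y \<and> Y \<subseteq> A \<longrightarrow>
        (\<Sum>a\<in>Y. mps_coeff (f a) m) = mps_coeff s m)"
      using N by blast
    then show ?ev
      unfolding eventually_finite_subsets_at_top mps_coeff_sum by (rule exI[of _ ?N])
  qed
  then show ?thesis
    by (simp add: has_sum_def tendsto_mps_iff)
qed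

corollary summable_on_mps_iff:
  fixes f :: "'b \<Rightarrow> ('v, 'a::cancel_comm_monoid_add) mps"
  shows "f summable_on A \<longleftrightarrow> (\<forall>m. finite {a\<in>A. mps_coeff (f a) m \<noteq> 0})"
proof
  assume *: "\<forall>m. finite {a\<in>A. mps_coeff (f a) m \<noteq> 0}"
  have "(f has_sum Abs_mps (\<lambda>m. \<Sum>a\<in>{a\<in>A. mps_coeff (f a) m \<noteq> 0}. mps_coeff (f a) m)) A"
    using * by (simp add: has_sum_mps_iff)
  then show "f summable_on A"
    by (auto simp: summable_on_def)
qed (auto simp: summable_on_def has_sum_mps_iff)

section \<open>Integer partitions, chromatic polynomials, multipartite graphs\<close>

text \<open>Partitions are normalised to have no zero parts, so \<open>l(\<mu>)\<close> is \<open>length \<mu>\<close>; \<open>[]\<close> is the empty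
  partition.\<close>

definition partitions :: "nat list set" where
  "partitions = {\<mu>. sorted_wrt (\<ge>) \<mu> \<and> 0 \<notin> set \<mu>}"

definition partition_fact :: "nat list \<Rightarrow> nat" where
  "partition_fact \<mu> = (\<Prod>k\<leftarrow>\<mu>. fact k)"

definition add_ones :: "nat \<Rightarrow> nat list \<Rightarrow> nat list" where
  "add_ones n \<mu> = \<mu> @ replicate n 1"

lemma add_ones_partition: "\<mu> \<in> partitions \<Longrightarrow> add_ones n \<mu> \<in> partitions"
proof -
  have "sorted_wrt (\<ge>) (replicate n (1 :: nat))"
    by (induction n) auto
  then show "\<mu> \<in> partitions \<Longrightarrow> add_ones n \<mu> \<in> partitions"
    by (auto simp: partitions_def add_ones_def sorted_wrt_append Suc_le_eq intro: gr0I)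
qed

type_synonym 'a graph = "'a set \<times> ('a \<times> 'a) set"

definition proper_colorings :: "'a graph \<Rightarrow> nat \<Rightarrow> ('a \<Rightarrow> nat) set" where
  "proper_colorings \<Gamma> k = {c \<in> fst \<Gamma> \<rightarrow>\<^sub>E {..<k}. \<forall>(u, v)\<in>snd \<Gamma>. c u \<noteq> c v}"

definition chromatic_poly :: "'a graph \<Rightarrow> rat poly" where
  "chromatic_poly \<Gamma> = (THE p. \<forall>k. poly p (of_nat k) = of_nat (card (proper_colorings \<Gamma> k)))"

definition complete_multipartite :: "nat list \<Rightarrow> (nat \<times> nat) graph" where
  "complete_multipartite \<mu> =
    (let V = {(i, j). i < length \<mu> \<and> j < \<mu> ! i}
     in (V, {(u, v). u \<in> V \<and> v \<in> V \<and> fst u \<noteq> fst v}))"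

lemma finite_complete_multipartite: "finite (fst (complete_multipartite \<mu>))"
proof -
  have "fst (complete_multipartite \<mu>) = Sigma {..<length \<mu>} (\<lambda>i. {..<\<mu> ! i})"
    by (auto simp: complete_multipartite_def)
  then show ?thesis by simp
qed

lemma rat_poly_eqI_nat:
  fixes p q :: "rat poly"
  assumes "\<And>k. poly p (of_nat k) = poly q (of_nat k)"
  shows "p = q"
proof (rule ccontr)
  assume "p \<noteq> q"
  then have "finite {x. poly (p - q) x = 0}"
    by (intro poly_roots_finite) simp
  moreover have "range (of_nat :: nat \<Rightarrow> rat) \<subseteq> {x. poly (p - q) x = 0}"
    using assms by auto
  moreover have "infinite (range (of_nat :: nat \<Rightarrow> rat))"
    by (simp add: finite_image_iff inj_of_nat)
  ultimately show False
    using finite_subset by blast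
qed

lemma ex_poly_binomial: "\<exists>p :: rat poly. \<forall>k. poly p (of_nat k) = of_nat (k choose j)"
proof -
  let ?p = "smult (1 / fact j) (\<Prod>i=0..<j. [:- of_nat i, 1:]) :: rat poly"
  have "poly ?p (of_nat k) = of_nat (k choose j)" for k
    by (simp add: poly_prod binomial_gbinomial gbinomial_prod_rev)
  then show ?thesis by blast
qed

theorem poly_chromatic_poly:
  fixes \<Gamma> :: "'a graph"
  assumes fin: "finite (fst \<Gamma>)" and E: "snd \<Gamma> \<subseteq> fst \<Gamma> \<times> fst \<Gamma>"
  shows "poly (chromatic_poly \<Gamma>) (of_nat k) = of_nat (card (proper_colorings \<Gamma> k))"
proof -
  define V where "V = fst \<Gamma>"
  have finV: "finite V" using fin by (simp add: V_def)
  define C where "C = (\<lambda>S::nat set. {c \<in> V \<rightarrow>\<^sub>E S. c ` V = S \<and> (\<forall>(u, v)\<in>snd \<Gamma>. c u \<noteq> c v)})"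
  have finC: "finite (C S)" for S
  proof (cases "finite S")
    case True
    have "finite (V \<rightarrow>\<^sub>E S)" using finV True by (intro finite_PiE) auto
    then show ?thesis by (auto simp: C_def)
  next
    case False
    then have "C S = {}" using finV by (auto simp: C_def)
    then show ?thesis by simp
  qed
  have cardC: "card (C S) = card (C {..<card S})" if "finite S" for S
  proof -
    obtain h where h: "bij_betw h S {..<card S}"
      using ex_bij_betw_finite_nat[OF \<open>finite S\<close>] by (auto simp: atLeast0LessThan)
    define h' where "h' = the_inv_into S h"
    have h': "bij_betw h' {..<card S} S"
      unfolding h'_def using h by (rule bij_betw_the_inv_into)
    have hh: "h' (h x) = x" if "x \<in> S" for x
      using h that unfolding h'_def by (simp add: bij_betw_def the_inv_into_f_f)
    have hh': "h (h' y) = y" if "y \<in> {..<card S}" for y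
      using h that unfolding h'_def by (simp add: f_the_inv_into_f_bij_betw)
    have step: "restrict (g \<circ> c) V \<in> C T" if g: "bij_betw g S' T" and c: "c \<in> C S'" for g c S' T
    proof -
      have cV: "c ` V = S'" and proper: "\<And>u v. (u, v) \<in> snd \<Gamma> \<Longrightarrow> c u \<noteq> c v"
        using c by (auto simp: C_def)
      have im: "restrict (g \<circ> c) V ` V = T"
        using g cV by (auto simp: bij_betw_def)
      moreover have "restrict (g \<circ> c) V u \<noteq> restrict (g \<circ> c) V v" if "(u, v) \<in> snd \<Gamma>" for u v
      proof -
        have uv: "u \<in> V" "v \<in> V" using that E by (auto simp: V_def)
        then have "c u \<in> S'" "c v \<in> S'" using cV by auto
        then show ?thesis using uv proper[OF that] g by (auto simp: bij_betw_def dest: inj_onD)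
      qed
      moreover have "restrict (g \<circ> c) V \<in> V \<rightarrow>\<^sub>E T"
        using im by (auto simp: PiE_iff)
      ultimately show ?thesis unfolding C_def by blast
    qed
    have "bij_betw (\<lambda>c. restrict (h \<circ> c) V) (C S) (C {..<card S})"
    proof (rule bij_betw_byWitness[where f' = "\<lambda>c. restrict (h' \<circ> c) V"])
      show "\<forall>c\<in>C S. restrict (h' \<circ> restrict (h \<circ> c) V) V = c"
        by (auto simp: C_def hh PiE_iff fun_eq_iff extensional_def)
      show "\<forall>c\<in>C {..<card S}. restrict (h \<circ> restrict (h' \<circ> c) V) V = c"
        using hh' by (auto simp: C_def PiE_iff fun_eq_iff extensional_def)
      show "(\<lambda>c. restrict (h \<circ> c) V) ` C S \<subseteq> C {..<card S}" using step[OF h] by blast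
      show "(\<lambda>c. restrict (h' \<circ> c) V) ` C {..<card S} \<subseteq> C S" using step[OF h'] by blast
    qed
    then show ?thesis by (rule bij_betw_same_card)
  qed
  have count: "card (proper_colorings \<Gamma> k) = (\<Sum>j\<le>card V. (k choose j) * card (C {..<j}))" for k
  proof -
    have "proper_colorings \<Gamma> k = (\<Union>S\<in>Pow {..<k}. C S)"
      by (auto simp: proper_colorings_def C_def V_def PiE_iff)
    then have "card (proper_colorings \<Gamma> k) = (\<Sum>S\<in>Pow {..<k}. card (C S))"
      using finC by (simp add: card_UN_disjoint C_def disjoint_iff)
    also have "\<dots> = (\<Sum>S\<in>Pow {..<k}. card (C {..<card S}))"
      by (intro sum.cong refl cardC) (auto intro: finite_subset)
    also have "\<dots> = (\<Sum>j\<le>k. \<Sum>S\<in>{S\<in>Pow {..<k}. card S = j}. card (C {..<card S}))"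
      by (rule sum.group[symmetric]) (auto intro: card_mono[of "{..<k}", simplified])
    also have "\<dots> = (\<Sum>j\<le>k. (k choose j) * card (C {..<j}))"
    proof (intro sum.cong refl)
      fix j
      have "card {S\<in>Pow {..<k}. card S = j} = k choose j"
        using n_subsets[of "{..<k}" j] by (simp add: Pow_def)
      then show "(\<Sum>S\<in>{S\<in>Pow {..<k}. card S = j}. card (C {..<card S})) =
          (k choose j) * card (C {..<j})"
        by simp
    qed
    also have "\<dots> = (\<Sum>j\<le>max k (card V). (k choose j) * card (C {..<j}))"
      by (intro sum.mono_neutral_left) (auto simp: binomial_eq_0)
    also have "\<dots> = (\<Sum>j\<le>card V. (k choose j) * card (C {..<j}))"
    proof (intro sum.mono_neutral_right ballI)
      fix j assume "j \<in> {..max k (card V)} - {..card V}"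
      then have "card V < j" by auto
      have "C {..<j} = {}"
      proof (rule ccontr)
        assume "C {..<j} \<noteq> {}"
        then obtain c where "c ` V = {..<j}" by (auto simp: C_def)
        then show False using card_image_le[OF finV, of c] \<open>card V < j\<close> by simp
      qed
      then show "(k choose j) * card (C {..<j}) = 0" by simp
    qed auto
    finally show ?thesis .
  qed
  obtain b :: "nat \<Rightarrow> rat poly" where b: "\<And>j k. poly (b j) (of_nat k) = of_nat (k choose j)"
    using ex_poly_binomial by metis
  define p where "p = (\<Sum>j\<le>card V. smult (of_nat (card (C {..<j}))) (b j))"
  have p: "\<forall>k. poly p (of_nat k) = of_nat (card (proper_colorings \<Gamma> k))"
    by (simp add: p_def poly_sum b count mult.commute)
  have "\<forall>k. poly (chromatic_poly \<Gamma>) (of_nat k) = of_nat (card (proper_colorings \<Gamma> k))"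
    unfolding chromatic_poly_def
  proof (rule theI)
    fix p' assume "\<forall>k. poly p' (of_nat k) = rat_of_nat (card (proper_colorings \<Gamma> k))"
    then show "p' = p" using p by (intro rat_poly_eqI_nat) simp
  qed (rule p)
  then show ?thesis by blast
qed

corollary poly_chromatic_poly_complete_multipartite:
  "poly (chromatic_poly (complete_multipartite \<mu>)) (of_nat k) =
     of_nat (card (proper_colorings (complete_multipartite \<mu>) k))"
  by (rule poly_chromatic_poly[OF finite_complete_multipartite])
     (auto simp: complete_multipartite_def)

lemma chromatic_poly_empty: "chromatic_poly (complete_multipartite []) = 1"
proof (rule rat_poly_eqI_nat)
  fix k
  have "proper_colorings (complete_multipartite []) k = {\<lambda>_. undefined}"
    by (simp add: proper_colorings_def complete_multipartite_def)
  then show "poly (chromatic_poly (complete_multipartite [])) (of_nat k) = poly 1 (of_nat k)"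
    by (simp add: poly_chromatic_poly_complete_multipartite)
qed

section \<open>Symmetric functions and the binomial series\<close>

text \<open>Power series in \<open>z\<close> and \<open>x\<^sub>0, x\<^sub>1, \<dots>\<close>; the coefficient ring \<open>\<rat>[q]\<close> is \<^typ>\<open>rat poly\<close>, whose
  indeterminate plays the role of \<open>q\<close>.\<close>

datatype indet = Zvar | Xvar nat

type_synonym series = "(indet, rat poly) mps"

abbreviation qq :: "rat poly" where
  "qq \<equiv> [:0, 1:]"

definition rat_const :: "rat \<Rightarrow> series" where
  "rat_const r = mps_const [:r:]"

definition zz :: series where
  "zz = mps_var Zvar"

definition xx :: "nat \<Rightarrow> series" where
  "xx i = mps_var (Xvar i)"

definition power_sum :: "nat \<Rightarrow> series" where
  "power_sum n = (\<Sum>\<^sub>\<infinity>i\<in>UNIV. xx i ^ n)"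

text \<open>\<open>m\<^sub>\<mu>\<close> is the sum of all distinct monomials in the \<open>x\<^sub>i\<close> whose nonzero exponents, in some order,
  are the parts of \<open>\<mu>\<close>.\<close>

definition monomial_sym :: "nat list \<Rightarrow> series" where
  "monomial_sym \<mu> = Abs_mps (\<lambda>m.
     if Poly_Mapping.keys m \<subseteq> range Xvar \<and>
        image_mset (Poly_Mapping.lookup m) (mset_set (Poly_Mapping.keys m)) = mset \<mu>
     then 1 else 0)"

text \<open>The polynomial \<open>q (q - 1) \<dots> (q - j + 1) / j!\<close>.  (The constant \<^term>\<open>(gchoose)\<close> is
  restricted to fields by a type constraint.)\<close>

definition q_choose :: "nat \<Rightarrow> rat poly" where
  "q_choose j = smult (1 / fact j) (\<Prod>i<j. qq - of_nat i)"

text \<open>\<open>f\<^sup>q\<close> for \<open>f = 1 + u\<close> where \<open>u\<close> has constant term \<open>0\<close>.\<close>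

definition q_power :: "series \<Rightarrow> series" where
  "q_power f = (\<Sum>\<^sub>\<infinity>j\<in>UNIV. mps_const (q_choose j) * (f - 1) ^ j)"

subsection \<open>Summability of the defining series\<close>

lemma mps_coeff_const_mult:
  fixes f :: "('v, 'a::comm_ring_1) mps"
  shows "mps_coeff (mps_const c * f) m = c * mps_coeff f m"
proof -
  have "mps_coeff (mps_const c * f) m =
      (\<Sum>p\<in>monomial_splits m. if p = (0, m) then c * mps_coeff f m else 0)"
    unfolding mps_coeff_mult
    by (intro sum.cong) (auto simp: mps_const_def monomial_splits_def split: if_splits)
  also have "\<dots> = c * mps_coeff f m"
    by (simp add: sum.delta) (simp add: monomial_splits_def)
  finally show ?thesis .
qed

lemma mps_coeff_var_power:
  "mps_coeff (mps_var v ^ n :: ('v, 'a::comm_ring_1) mps) m =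
     (if m = Poly_Mapping.single v n then 1 else 0)"
proof (induction n arbitrary: m)
  case 0
  then show ?case by (simp add: mps_coeff_1)
next
  case (Suc n)
  let ?s = "\<lambda>n. Poly_Mapping.single v n"
  have coeff1: "mps_coeff (mps_var v :: ('v, 'a) mps) a = (if a = ?s 1 then 1 else 0)" for a
    by (simp add: mps_var_def)
  have s: "?s 1 + ?s n = ?s (Suc n)" by (simp flip: single_add)
  have "mps_coeff (mps_var v ^ Suc n :: ('v, 'a) mps) m =
      (\<Sum>p\<in>monomial_splits m. if p = (?s 1, ?s n) then 1 else 0)"
    unfolding power_Suc mps_coeff_mult
    by (intro sum.cong) (auto simp: Suc.IH coeff1 split: if_splits)
  also have "\<dots> = (if m = ?s (Suc n) then 1 else 0)"
    using s by (subst sum.delta[OF finite_monomial_splits]) (auto simp: monomial_splits_def)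
  finally show ?case .
qed

lemma power_sum_summable:
  assumes "n \<ge> 1"
  shows "(\<lambda>i. xx i ^ n) summable_on UNIV"
  unfolding summable_on_mps_iff
proof
  fix m :: "indet \<Rightarrow>\<^sub>0 nat"
  have "{i. mps_coeff (xx i ^ n) m \<noteq> 0} \<subseteq> {i. Xvar i \<in> Poly_Mapping.keys m}"
    using assms by (auto simp: xx_def mps_coeff_var_power split: if_splits)
  moreover have "finite {i. Xvar i \<in> Poly_Mapping.keys m}"
    using finite_vimageI[of "Poly_Mapping.keys m" Xvar] by (auto simp: inj_def vimage_def)
  ultimately show "finite {i \<in> UNIV. mps_coeff (xx i ^ n) m \<noteq> 0}"
    using finite_subset by auto
qed

lemma mps_coeff_power_sum:
  assumes "n \<ge> 1"
  shows "mps_coeff (power_sum n) m = (if \<exists>i. m = Poly_Mapping.single (Xvar i) n then 1 else 0)"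
proof -
  have "((\<lambda>i. xx i ^ n) has_sum power_sum n) UNIV"
    using power_sum_summable[OF assms] by (simp add: power_sum_def)
  then have *: "mps_coeff (power_sum n) m =
      (\<Sum>i\<in>{i. mps_coeff (xx i ^ n) m \<noteq> 0}. mps_coeff (xx i ^ n) m)"
    by (simp add: has_sum_mps_iff)
  show ?thesis
  proof (cases "\<exists>i. m = Poly_Mapping.single (Xvar i) n")
    case True
    then obtain i where i: "m = Poly_Mapping.single (Xvar i) n" by blast
    have "{i. mps_coeff (xx i ^ n) m \<noteq> 0} = {i}"
    proof -
      have "i' = i" if "Poly_Mapping.single (Xvar i) n = Poly_Mapping.single (Xvar i') n" for i'
        using arg_cong[OF that, of "\<lambda>m. Poly_Mapping.lookup m (Xvar i)"] assms
        by (auto simp: lookup_single when_def split: if_splits)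
      then show ?thesis by (auto simp: i xx_def mps_coeff_var_power)
    qed
    then show ?thesis using * True by (simp add: i xx_def mps_coeff_var_power)
  next
    case False
    then show ?thesis using * by (simp add: xx_def mps_coeff_var_power)
  qed
qed

lemma power_sum_series_summable: "(\<lambda>n. mps_const (c n) * power_sum n) summable_on {1..}"
  unfolding summable_on_mps_iff
proof
  fix m :: "indet \<Rightarrow>\<^sub>0 nat"
  have "n \<in> Poly_Mapping.lookup m ` Poly_Mapping.keys m"
    if n: "n \<in> {1..}" "mps_coeff (mps_const (c n) * power_sum n) m \<noteq> 0" for n
  proof -
    obtain i where "m = Poly_Mapping.single (Xvar i) n"
      using n by (auto simp: mps_coeff_const_mult mps_coeff_power_sum split: if_splits)
    then show ?thesis
      using n(1) by (intro image_eqI[of _ _ "Xvar i"]) auto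
  qed
  then have "{n\<in>{1..}. mps_coeff (mps_const (c n) * power_sum n) m \<noteq> 0} \<subseteq>
      Poly_Mapping.lookup m ` Poly_Mapping.keys m"
    by blast
  then show "finite {n\<in>{1..}. mps_coeff (mps_const (c n) * power_sum n) m \<noteq> 0}"
    by (rule finite_subset) simp
qed

definition mdegree :: "('v \<Rightarrow>\<^sub>0 nat) \<Rightarrow> nat" where
  "mdegree m = (\<Sum>v\<in>Poly_Mapping.keys m. Poly_Mapping.lookup m v)"

lemma mdegree_add: "mdegree (a + b) = mdegree a + mdegree b"
proof -
  let ?K = "Poly_Mapping.keys a \<union> Poly_Mapping.keys b"
  have *: "mdegree m = (\<Sum>v\<in>?K. Poly_Mapping.lookup m v)" if "Poly_Mapping.keys m \<subseteq> ?K" for m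
    unfolding mdegree_def using that by (intro sum.mono_neutral_left) (auto simp: in_keys_iff)
  show ?thesis
    using keys_add[of a b] by (simp add: * lookup_add sum.distrib)
qed

lemma mdegree_eq_0: "mdegree m = 0 \<longleftrightarrow> m = 0"
  by (auto simp: mdegree_def in_keys_iff intro!: poly_mapping_eqI)

lemma mps_coeff_power_eq_0:
  fixes u :: "('v, 'a::comm_ring_1) mps"
  assumes "mps_coeff u 0 = 0" "mdegree m < j"
  shows "mps_coeff (u ^ j) m = 0"
  using assms(2)
proof (induction j arbitrary: m)
  case (Suc j)
  have "mps_coeff u a * mps_coeff (u ^ j) b = 0" if "(a, b) \<in> monomial_splits m" for a b
  proof (cases "a = 0")
    case False
    have "mdegree m = mdegree a + mdegree b"
      using that by (auto simp: monomial_splits_def mdegree_add)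
    then have "mdegree b < j" using False Suc.prems mdegree_eq_0[of a] by simp
    then show ?thesis using Suc.IH by simp
  qed (use assms(1) in simp)
  then show ?case
    by (auto simp: mps_coeff_mult intro!: sum.neutral)
qed simp

lemma q_power_summable:
  assumes "mps_coeff f 0 = 1"
  shows "(\<lambda>j. mps_const (q_choose j) * (f - 1) ^ j) summable_on UNIV"
  unfolding summable_on_mps_iff
proof
  fix m
  have "mps_coeff (f - 1) 0 = 0" using assms by (simp add: mps_coeff_1)
  then have "{j. mps_coeff (mps_const (q_choose j) * (f - 1) ^ j) m \<noteq> 0} \<subseteq> {..mdegree m}"
    using mps_coeff_power_eq_0[of "f - 1" m] by (force simp: mps_coeff_const_mult not_less[symmetric])
  then show "finite {j \<in> UNIV. mps_coeff (mps_const (q_choose j) * (f - 1) ^ j) m \<noteq> 0}"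
    using finite_subset by auto
qed

end

theory Submission
  imports Defs
begin

text \<open>Everything is compared coefficientwise.  Over \<open>\<rat>[q]\<close> it suffices to take \<open>q = k\<close> a natural
  number, where \<open>f\<^sup>q\<close> becomes the ordinary power \<open>f ^ k\<close>.  Reading power series as exponential
  generating functions, a product distributes a set \<open>V\<close> of typed vertices over its factors, so
  \<open>f ^ k\<close> counts the maps from \<open>V\<close> to \<open>k\<close> colours whose colour classes are structures counted by
  \<open>f\<close>.  For \<open>f = 1 + z + \<Sum>\<^sub>n p\<^sub>n / n!\<close> these structures are the empty set, one vertex of type \<open>z\<close>,
  and a nonempty set of vertices of a single type \<open>x\<^sub>i\<close>; hence the maps are the proper colourings
  of the complete multipartite graph whose blocks are the vertices of type \<open>x\<^sub>i\<close>, for each \<open>i\<close>, and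
  the single vertices of type \<open>z\<close>.\<close>

section \<open>Exponential generating functions\<close>

definition mono_fact :: "('v \<Rightarrow>\<^sub>0 nat) \<Rightarrow> nat" where
  "mono_fact m = (\<Prod>v\<in>Poly_Mapping.keys m. fact (Poly_Mapping.lookup m v))"

lemma mono_fact_superset:
  assumes "finite A" "Poly_Mapping.keys m \<subseteq> A"
  shows "mono_fact m = (\<Prod>v\<in>A. fact (Poly_Mapping.lookup m v))"
  unfolding mono_fact_def using assms
  by (intro prod.mono_neutral_left) (auto simp: in_keys_iff)

lemma mono_fact_0 [simp]: "mono_fact 0 = 1"
  by (simp add: mono_fact_def)

lemma mono_fact_single [simp]: "mono_fact (Poly_Mapping.single v n) = fact n"
  by (simp add: mono_fact_def)

lemma mono_fact_pos: "mono_fact m > 0"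
  by (simp add: mono_fact_def prod_pos)

lemma mono_fact_add_single:
  "mono_fact (m + Poly_Mapping.single v 1) = (Poly_Mapping.lookup m v + 1) * mono_fact m"
proof -
  let ?A = "insert v (Poly_Mapping.keys m)"
  have sub: "Poly_Mapping.keys (m + Poly_Mapping.single v 1) \<subseteq> ?A"
    using keys_add[of m "Poly_Mapping.single v 1"] by auto
  have "mono_fact (m + Poly_Mapping.single v 1) =
      (\<Prod>w\<in>?A. fact (Poly_Mapping.lookup (m + Poly_Mapping.single v 1) w))"
    by (intro mono_fact_superset sub) auto
  also have "\<dots> = fact (Poly_Mapping.lookup m v + 1) *
      (\<Prod>w\<in>?A - {v}. fact (Poly_Mapping.lookup m w))"
    by (subst prod.remove[of _ v]) (auto simp: lookup_add lookup_single when_def intro!: prod.cong arg_cong[of _ _ fact] arg_cong2[of _ _ _ _ "(*)"] split: if_splits)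
  also have "\<dots> = (Poly_Mapping.lookup m v + 1) * (\<Prod>w\<in>?A. fact (Poly_Mapping.lookup m w))"
    by (subst (2) prod.remove[of _ v]) (auto simp: algebra_simps)
  also have "(\<Prod>w\<in>?A. fact (Poly_Mapping.lookup m w)) = mono_fact m"
    by (rule mono_fact_superset[symmetric]) auto
  finally show ?thesis .
qed

section \<open>Monomials of sets of typed vertices\<close>

text \<open>The multiset of types occurring in \<open>V\<close>, written as a monomial: cutting
  \<open>V\<close> in two then corresponds to factoring the monomial.\<close>

definition type_mono :: "('u \<Rightarrow> 'v) \<Rightarrow> 'u set \<Rightarrow> ('v \<Rightarrow>\<^sub>0 nat)" where
  "type_mono t V = (\<Sum>u\<in>V. Poly_Mapping.single (t u) 1)"

lemma type_mono_empty [simp]: "type_mono t {} = 0"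
  by (simp add: type_mono_def)

lemma type_mono_insert:
  "finite V \<Longrightarrow> x \<notin> V \<Longrightarrow> type_mono t (insert x V) = type_mono t V + Poly_Mapping.single (t x) 1"
  by (simp add: type_mono_def add.commute)

lemma type_mono_Diff:
  assumes "finite V" "S \<subseteq> V"
  shows "type_mono t S + type_mono t (V - S) = type_mono t V"
  using sum.subset_diff[OF assms(2,1), of "\<lambda>u. Poly_Mapping.single (t u) (1::nat)"]
  unfolding type_mono_def by (simp only: add.commute)

lemma lookup_type_mono:
  assumes "finite V"
  shows "Poly_Mapping.lookup (type_mono t V) v = card {u \<in> V. t u = v}"
  using assms
proof (induction V)
  case (insert x V)
  have "{u \<in> insert x V. t u = v} = (if t x = v then insert x {u \<in> V. t u = v} else {u \<in> V. t u = v})"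
    by auto
  then show ?case
    using insert by (simp add: type_mono_insert lookup_add lookup_single when_def)
qed simp

lemma keys_type_mono: "finite V \<Longrightarrow> Poly_Mapping.keys (type_mono t V) = t ` V"
  by (auto simp: in_keys_iff lookup_type_mono)

lemma mono_diff_single:
  fixes m :: "'v \<Rightarrow>\<^sub>0 nat"
  assumes "Poly_Mapping.lookup m v > 0"
  shows "\<exists>m'. m = m' + Poly_Mapping.single v 1"
proof
  show "m = (m - Poly_Mapping.single v 1) + Poly_Mapping.single v 1"
    using assms by (intro poly_mapping_eqI) (auto simp: lookup_add lookup_minus lookup_single when_def)
qed

text \<open>The count is the product over all types of the binomial coefficients for choosing the
  vertices of that type, with denominators cleared to stay in the naturals. The induction on
  \<open>V\<close> is Pascal's rule: a subset contains the new vertex \<open>x\<close> or avoids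
  it.\<close>

lemma card_subsets_type_mono:
  assumes "finite V" "type_mono t V = a + b"
  shows "mono_fact a * mono_fact b * card {S \<in> Pow V. type_mono t S = a} = mono_fact (a + b)"
  using assms
proof (induction V arbitrary: a b)
  case empty
  then have "(a, b) \<in> monomial_splits 0" by (simp add: monomial_splits_def)
  then have "a = 0" "b = 0" by auto
  moreover have "{S. S = {} \<and> type_mono t S = 0} = {{}}" by auto
  ultimately show ?case by simp
next
  case (insert x V)
  let ?v = "t x"
  let ?e = "Poly_Mapping.single ?v 1 :: 'b \<Rightarrow>\<^sub>0 nat"
  let ?C = "\<lambda>a. {S \<in> Pow V. type_mono t S = a}"
  let ?D = "{S \<in> Pow V. type_mono t S + ?e = a}"
  have eq: "a + b = type_mono t V + ?e"
    using insert by (simp add: type_mono_insert)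
  have fin: "finite S" if "S \<subseteq> V" for S using that insert.hyps finite_subset by blast
  have ins: "type_mono t (insert x S) = type_mono t S + ?e" if "S \<subseteq> V" for S
    using that fin[OF that] insert.hyps by (intro type_mono_insert) auto
  have "{S \<in> Pow (insert x V). type_mono t S = a} = ?C a \<union> insert x ` ?D"
    unfolding Pow_insert using ins by auto
  moreover have "?C a \<inter> insert x ` ?D = {}" using insert.hyps by auto
  moreover have "inj_on (insert x) (Pow V)"
    using insert.hyps(2) by (intro inj_on_inverseI[of _ "\<lambda>S. S - {x}"]) auto
  then have "inj_on (insert x) ?D"
    by (rule inj_on_subset) auto
  ultimately have card: "card {S \<in> Pow (insert x V). type_mono t S = a} = card (?C a) + card ?D"
    using insert.hyps by (simp add: card_Un_disjoint card_image)
  \<comment> \<open>Subsets containing \<open>x\<close>: dropping \<open>x\<close> lowers the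
    exponent of its type in \<open>a\<close> by one, which releases that exponent from the factorial
    of \<open>a\<close>. If the exponent is 0, both sides vanish.\<close>
  have A: "mono_fact a * mono_fact b * card ?D =
      Poly_Mapping.lookup a ?v * mono_fact (type_mono t V)"
  proof (cases "Poly_Mapping.lookup a ?v = 0")
    case True
    then have "?D = {}" by (auto simp: lookup_add)
    then show ?thesis using True by (simp only: card.empty)
  next
    case False
    then obtain a' where a': "a = a' + ?e" using mono_diff_single[of a ?v] by auto
    have "type_mono t V + ?e = (a' + b) + ?e" using eq unfolding a' by (metis add.assoc add.commute)
    then have V: "type_mono t V = a' + b" by (simp only: add_right_cancel)
    have D: "?D = ?C a'" unfolding a' by (simp only: add_right_cancel)
    have a: "mono_fact a = Poly_Mapping.lookup a ?v * mono_fact a'"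
      unfolding a' mono_fact_add_single by (simp add: lookup_add)
    show ?thesis
      unfolding D V a insert.IH[OF V, symmetric] by (simp only: mult_ac)
  qed
  \<comment> \<open>Subsets avoiding \<open>x\<close>: now \<open>x\<close> lies in the complement,
    so \<open>b\<close> loses the factor instead. If \<open>b\<close> has no such factor, no such
    subset exists.\<close>
  have B: "mono_fact a * mono_fact b * card (?C a) =
      Poly_Mapping.lookup b ?v * mono_fact (type_mono t V)"
  proof (cases "Poly_Mapping.lookup b ?v = 0")
    case True
    have "?C a = {}"
    proof -
      have "type_mono t S \<noteq> a" if "S \<subseteq> V" for S
      proof
        assume "type_mono t S = a"
        then have "type_mono t V = a + type_mono t (V - S)"
          using type_mono_Diff[of V S t] insert.hyps that by simp
        then have "a + b = a + (type_mono t (V - S) + ?e)" using eq by (metis add.assoc)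
        then have "b = type_mono t (V - S) + ?e" by (simp only: add_left_cancel)
        then show False using True by (simp add: lookup_add)
      qed
      then show ?thesis by auto
    qed
    then show ?thesis using True by (simp only: card.empty)
  next
    case False
    then obtain b' where b': "b = b' + ?e" using mono_diff_single[of b ?v] by auto
    have "type_mono t V + ?e = (a + b') + ?e" using eq unfolding b' by (metis add.assoc)
    then have V: "type_mono t V = a + b'" by (simp only: add_right_cancel)
    have b: "mono_fact b = Poly_Mapping.lookup b ?v * mono_fact b'"
      unfolding b' mono_fact_add_single by (simp add: lookup_add)
    show ?thesis
      unfolding V b insert.IH[OF V, symmetric] by (simp only: mult_ac)
  qed
  \<comment> \<open>The two released factors add up to exactly the factor by which the factorial of
    the monomial grows when \<open>x\<close> is added.\<close>
  have ab: "Poly_Mapping.lookup a ?v + Poly_Mapping.lookup b ?v = Poly_Mapping.lookup (type_mono t V) ?v + 1"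
    using arg_cong[OF eq, of "\<lambda>m. Poly_Mapping.lookup m ?v"] by (simp add: lookup_add)
  have "mono_fact a * mono_fact b * card {S \<in> Pow (insert x V). type_mono t S = a} =
      (Poly_Mapping.lookup a ?v + Poly_Mapping.lookup b ?v) * mono_fact (type_mono t V)"
    by (simp only: card add_mult_distrib2 A B add_mult_distrib)
  also have "\<dots> = mono_fact (a + b)"
    by (simp only: ab eq mono_fact_add_single)
  finally show ?case .
qed

text \<open>The vertex \<open>u\<close> is labelled and has type \<open>t u\<close>; the factor \<open>mono_fact\<close> turns the ordinary coefficient
  into an exponential one.\<close>

definition egf_coeff :: "('v, 'a::comm_ring_1) mps \<Rightarrow> ('u \<Rightarrow> 'v) \<Rightarrow> 'u set \<Rightarrow> 'a" where
  "egf_coeff f t V = of_nat (mono_fact (type_mono t V)) * mps_coeff f (type_mono t V)"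

text \<open>Subsets are grouped by the types of \<open>S\<close> and of its complement. A pair
  \<open>(a, b)\<close> arises from m! / (a! b!) subsets, where m is the monomial of
  \<open>V\<close>, and this turns the weights a! b! into m!.\<close>

lemma egf_coeff_mult:
  assumes "finite V"
  shows "egf_coeff (f * g) t V = (\<Sum>S\<in>Pow V. egf_coeff f t S * egf_coeff g t (V - S))"
proof -
  let ?m = "type_mono t V"
  let ?h = "\<lambda>S. (type_mono t S, type_mono t (V - S))"
  have "(\<Sum>S\<in>Pow V. egf_coeff f t S * egf_coeff g t (V - S)) =
      (\<Sum>p\<in>monomial_splits ?m. \<Sum>S\<in>{S \<in> Pow V. ?h S = p}. egf_coeff f t S * egf_coeff g t (V - S))"
    using assms type_mono_Diff[OF assms, of _ t]
    by (intro sum.group[symmetric] finite_monomial_splits) (auto simp: monomial_splits_def)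
  also have "\<dots> = (\<Sum>(a, b)\<in>monomial_splits ?m.
      of_nat (mono_fact ?m) * (mps_coeff f a * mps_coeff g b))"
  proof (intro sum.cong refl, clarify)
    fix a b assume "(a, b) \<in> monomial_splits ?m"
    then have ab: "?m = a + b" by (simp add: monomial_splits_def)
    \<comment> \<open>Cancelling \<open>a\<close> from the monomial of \<open>V\<close> forces the
      complement to have monomial \<open>b\<close>.\<close>
    have "{S \<in> Pow V. ?h S = (a, b)} = {S \<in> Pow V. type_mono t S = a}"
      using type_mono_Diff[OF assms, of _ t] ab by (auto intro: add_left_imp_eq[of a])
    then have "(\<Sum>S\<in>{S \<in> Pow V. ?h S = (a, b)}. egf_coeff f t S * egf_coeff g t (V - S)) =
        (\<Sum>S\<in>{S \<in> Pow V. type_mono t S = a}.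
          of_nat (mono_fact a) * mps_coeff f a * (of_nat (mono_fact b) * mps_coeff g b))"
      by (intro sum.cong) (auto simp: egf_coeff_def)
    also have "\<dots> = of_nat (mono_fact a * mono_fact b * card {S \<in> Pow V. type_mono t S = a}) *
        (mps_coeff f a * mps_coeff g b)"
      by (simp add: mult_ac)
    finally show "(\<Sum>S\<in>{S \<in> Pow V. ?h S = (a, b)}. egf_coeff f t S * egf_coeff g t (V - S)) =
        of_nat (mono_fact ?m) * (mps_coeff f a * mps_coeff g b)"
      by (simp only: card_subsets_type_mono[OF assms ab] ab)
  qed
  also have "\<dots> = egf_coeff (f * g) t V"
    by (simp add: egf_coeff_def mps_coeff_mult sum_distrib_left case_prod_unfold)
  finally show ?thesis ..
qed

section \<open>Colourings with colour classes inside blocks\<close>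

text \<open>These are the proper colourings of the complete multipartite graph whose blocks are the
  fibres of \<open>b\<close>. Using a block map instead of edges allows a colour class to be removed
  without changing the other data.\<close>

definition block_colorings :: "('u \<Rightarrow> 'b) \<Rightarrow> 'u set \<Rightarrow> nat \<Rightarrow> ('u \<Rightarrow> nat) set" where
  "block_colorings b V k = {c \<in> V \<rightarrow>\<^sub>E {..<k}. \<forall>u\<in>V. \<forall>v\<in>V. c u = c v \<longrightarrow> b u = b v}"

lemma finite_block_colorings: "finite V \<Longrightarrow> finite (block_colorings b V k)"
  unfolding block_colorings_def
  by (rule finite_subset[OF _ finite_PiE[of V "\<lambda>_. {..<k}"]]) auto

text \<open>A colouring is determined by the class \<open>S\<close> of the last colour
  \<open>k\<close>, which lies in one block, and by its restriction to the other vertices, which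
  uses \<open>k\<close> colours.\<close>

lemma card_block_colorings_Suc:
  assumes "finite V"
  shows "card (block_colorings b V (Suc k)) =
    (\<Sum>S\<in>{S \<in> Pow V. \<forall>u\<in>S. \<forall>v\<in>S. b u = b v}. card (block_colorings b (V - S) k))"
proof -
  let ?M = "{S \<in> Pow V. \<forall>u\<in>S. \<forall>v\<in>S. b u = b v}"
  let ?f = "\<lambda>c. ({u \<in> V. c u = k}, restrict c {u \<in> V. c u \<noteq> k})"
  let ?g = "\<lambda>(S, c) u. if u \<in> S then k else c u"
  have "bij_betw ?f (block_colorings b V (Suc k)) (SIGMA S:?M. block_colorings b (V - S) k)"
  proof (rule bij_betw_byWitness[where f' = ?g])
    show "\<forall>c\<in>block_colorings b V (Suc k). ?g (?f c) = c"
      by (auto simp: block_colorings_def PiE_iff extensional_def)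
    show "\<forall>p\<in>(SIGMA S:?M. block_colorings b (V - S) k). ?f (?g p) = p"
    proof
      fix p assume "p \<in> (SIGMA S:?M. block_colorings b (V - S) k)"
      then obtain S c where p: "p = (S, c)" and S: "S \<subseteq> V" and c: "c \<in> block_colorings b (V - S) k"
        by auto
      have lt: "c u < k" if "u \<in> V" "u \<notin> S" for u
        using c that by (auto simp: block_colorings_def PiE_iff)
      have 1: "{u \<in> V. (if u \<in> S then k else c u) = k} = S"
        using S lt by (auto split: if_splits)
      have ext: "c u = undefined" if "u \<notin> V - S" for u
        using c that by (auto simp: block_colorings_def PiE_iff extensional_def)
      have 2: "restrict (\<lambda>u. if u \<in> S then k else c u) {u \<in> V. (if u \<in> S then k else c u) \<noteq> k} = c"
      proof
        fix u
        show "restrict (\<lambda>u. if u \<in> S then k else c u) {u \<in> V. (if u \<in> S then k else c u) \<noteq> k} u = c u"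
          using lt[of u] ext[of u] S by (cases "u \<in> S"; cases "u \<in> V") auto
      qed
      show "?f (?g p) = p" using 1 2 by (simp add: p)
    qed
    show "?f ` block_colorings b V (Suc k) \<subseteq> (SIGMA S:?M. block_colorings b (V - S) k)"
    proof clarify
      fix c assume c: "c \<in> block_colorings b V (Suc k)"
      then have lt: "c u < k" if "u \<in> V" "c u \<noteq> k" for u
        using that by (auto simp: block_colorings_def PiE_iff less_Suc_eq)
      have eq: "b u = b v" if "u \<in> V" "v \<in> V" "c u = c v" for u v
        using c that unfolding block_colorings_def by blast
      have "V - {u \<in> V. c u = k} = {u \<in> V. c u \<noteq> k}"
        by auto
      moreover have "restrict c {u \<in> V. c u \<noteq> k} \<in> {u \<in> V. c u \<noteq> k} \<rightarrow>\<^sub>E {..<k}"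
        using lt by auto
      ultimately have "restrict c {u \<in> V. c u \<noteq> k} \<in> block_colorings b (V - {u \<in> V. c u = k}) k"
        unfolding block_colorings_def using eq by simp
      moreover have "{u \<in> V. c u = k} \<in> ?M"
        using eq by auto
      ultimately show "{u \<in> V. c u = k} \<in> ?M \<and>
          restrict c {u \<in> V. c u \<noteq> k} \<in> block_colorings b (V - {u \<in> V. c u = k}) k"
        by blast
    qed
    show "?g ` (SIGMA S:?M. block_colorings b (V - S) k) \<subseteq> block_colorings b V (Suc k)"
    proof
      fix d assume "d \<in> ?g ` (SIGMA S:?M. block_colorings b (V - S) k)"
      then obtain p where p: "d = ?g p" "p \<in> (SIGMA S:?M. block_colorings b (V - S) k)"
        by (rule imageE)
      obtain S c where Sc: "p = (S, c)"
        by (cases p)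
      have "S \<in> ?M" and c: "c \<in> block_colorings b (V - S) k"
        using SigmaD1[OF p(2)[unfolded Sc]] SigmaD2[OF p(2)[unfolded Sc]] .
      then have S: "S \<subseteq> V" "\<And>u v. u \<in> S \<Longrightarrow> v \<in> S \<Longrightarrow> b u = b v"
        by blast+
      have d: "d = (\<lambda>u. if u \<in> S then k else c u)"
        using p(1) Sc by simp
      have lt: "c u < k" if "u \<in> V" "u \<notin> S" for u
        using c that by (auto simp: block_colorings_def PiE_iff)
      have eq: "b u = b v" if "u \<in> V - S" "v \<in> V - S" "c u = c v" for u v
        using c that unfolding block_colorings_def by blast
      have ext: "c u = undefined" if "u \<notin> V - S" for u
        using c that by (auto simp: block_colorings_def PiE_iff extensional_def)
      \<comment> \<open>Colours outside \<open>S\<close> are below \<open>k\<close>, so equally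
        coloured vertices lie both in \<open>S\<close> or both outside it.\<close>
      have "b u = b v" if uv: "u \<in> V" "v \<in> V" "(if u \<in> S then k else c u) = (if v \<in> S then k else c v)" for u v
        using uv lt eq S(2) by (metis DiffI less_irrefl)
      moreover have "(\<lambda>u. if u \<in> S then k else c u) \<in> V \<rightarrow>\<^sub>E {..<Suc k}"
        using S(1) lt ext by (auto simp: PiE_iff extensional_def less_Suc_eq)
      ultimately show "d \<in> block_colorings b V (Suc k)"
        unfolding block_colorings_def d by blast
    qed
  qed
  then have "card (block_colorings b V (Suc k)) = card (SIGMA S:?M. block_colorings b (V - S) k)"
    by (rule bij_betw_same_card)
  also have "\<dots> = (\<Sum>S\<in>?M. card (block_colorings b (V - S) k))"
    using assms by (intro card_SigmaI) (auto intro!: finite_block_colorings)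
  finally show ?thesis .
qed

text \<open>Here \<open>f\<close> counts the sets inside one block. Splitting off one factor of the
  power and splitting off the last colour class give the same recursion; for \<open>k = 0\<close>
  both sides are 1 on the empty set and 0 otherwise.\<close>

lemma egf_coeff_power:
  assumes "finite V"
    and "\<And>S. S \<subseteq> V \<Longrightarrow> egf_coeff f t S = (if \<forall>u\<in>S. \<forall>v\<in>S. b u = b v then 1 else 0)"
  shows "egf_coeff (f ^ k) t V = of_nat (card (block_colorings b V k))"
  using assms
proof (induction k arbitrary: V)
  case 0
  show ?case
  proof (cases "V = {}")
    case True
    then show ?thesis by (simp add: egf_coeff_def mps_coeff_1 block_colorings_def)
  next
    case False
    then have "block_colorings b V 0 = {}" by (auto simp: block_colorings_def PiE_iff)
    moreover have "type_mono t V \<noteq> 0"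
      using False 0 keys_type_mono[of V t] by auto
    ultimately show ?thesis by (simp add: egf_coeff_def mps_coeff_1)
  qed
next
  case (Suc k)
  define P where "P S \<longleftrightarrow> (\<forall>u\<in>S. \<forall>v\<in>S. b u = b v)" for S
  have f: "egf_coeff f t S = (if P S then 1 else 0)" if "S \<subseteq> V" for S
    using Suc.prems(2)[OF that] unfolding P_def .
  have IH: "egf_coeff (f ^ k) t (V - S) = of_nat (card (block_colorings b (V - S) k))" for S
  proof (rule Suc.IH)
    show "egf_coeff f t T = (if \<forall>u\<in>T. \<forall>v\<in>T. b u = b v then 1 else 0)" if "T \<subseteq> V - S" for T
      by (rule Suc.prems(2)) (use that in blast)
  qed (use Suc.prems(1) in simp)
  have "egf_coeff (f ^ Suc k) t V = (\<Sum>S\<in>Pow V. egf_coeff f t S * egf_coeff (f ^ k) t (V - S))"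
    by (simp add: egf_coeff_mult Suc.prems(1))
  also have "\<dots> = (\<Sum>S\<in>Pow V. if P S then of_nat (card (block_colorings b (V - S) k)) else 0)"
    by (intro sum.cong refl) (simp add: f IH)
  also have "\<dots> = of_nat (card (block_colorings b V (Suc k)))"
    unfolding card_block_colorings_Suc[OF Suc.prems(1)] P_def[symmetric]
    using Suc.prems(1) by (subst sum.inter_filter) (auto intro!: sum.cong)
  finally show ?case .
qed

text \<open>The first component of a vertex is the number of its block, so the block condition is
  the contrapositive of the edge condition.\<close>

lemma block_colorings_complete_multipartite:
  "block_colorings fst (fst (complete_multipartite \<mu>)) k = proper_colorings (complete_multipartite \<mu>) k"
  unfolding block_colorings_def proper_colorings_def complete_multipartite_def Let_def fst_conv snd_conv
  by blast

section \<open>The binomial series at natural exponents\<close>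

lemma mdegree_single: "mdegree (Poly_Mapping.single v n) = n"
  by (simp add: mdegree_def)

text \<open>As \<open>f - 1\<close> has no constant term, its j-th power has no monomial of degree
  below j, and the series becomes a finite sum.\<close>

lemma mps_coeff_q_power:
  assumes "mps_coeff f 0 = 1"
  shows "mps_coeff (q_power f) m = (\<Sum>j\<le>mdegree m. q_choose j * mps_coeff ((f - 1) ^ j) m)"
proof -
  have 0: "mps_coeff (f - 1) 0 = 0" using assms by (simp add: mps_coeff_1)
  have "((\<lambda>j. mps_const (q_choose j) * (f - 1) ^ j) has_sum q_power f) UNIV"
    using q_power_summable[OF assms] unfolding q_power_def by simp
  then have "mps_coeff (q_power f) m =
      (\<Sum>j\<in>{j. q_choose j * mps_coeff ((f - 1) ^ j) m \<noteq> 0}. q_choose j * mps_coeff ((f - 1) ^ j) m)"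
    by (simp add: has_sum_mps_iff mps_coeff_const_mult)
  also have "\<dots> = (\<Sum>j\<le>mdegree m. q_choose j * mps_coeff ((f - 1) ^ j) m)"
    using mps_coeff_power_eq_0[of "f - 1" m, OF 0]
    by (intro sum.mono_neutral_left) (auto simp: not_less[symmetric])
  finally show ?thesis .
qed

lemma poly_q_choose: "poly (q_choose j) (of_nat k) = of_nat (k choose j)"
  by (simp add: q_choose_def poly_prod binomial_gbinomial gbinomial_prod_rev atLeast0LessThan)

lemma mps_coeff_of_nat_mult:
  "mps_coeff (of_nat n * f :: ('v, 'a::comm_ring_1) mps) m = of_nat n * mps_coeff f m"
  by (induction n) (auto simp: algebra_simps)

text \<open>At q = k this is the binomial theorem. The coefficients of \<open>f\<close> may
  themselves depend on q, hence the evaluation on the right as well.\<close>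

lemma poly_mps_coeff_q_power:
  assumes "mps_coeff f 0 = 1"
  shows "poly (mps_coeff (q_power f) m) (of_nat k) = poly (mps_coeff (f ^ k) m) (of_nat k)"
proof -
  define u where "u = f - 1"
  have u0: "mps_coeff u 0 = 0" using assms by (simp add: u_def mps_coeff_1)
  let ?g = "\<lambda>j. of_nat (k choose j) * mps_coeff (u ^ j) m"
  have "f ^ k = (\<Sum>j\<le>k. of_nat (k choose j) * u ^ j)"
    using binomial_ring[of u 1 k] by (simp add: u_def)
  then have "mps_coeff (f ^ k) m = (\<Sum>j\<le>k. ?g j)"
    by (simp add: mps_coeff_sum mps_coeff_of_nat_mult)
  \<comment> \<open>A common range reconciles the two truncations: binomial coefficients vanish
    beyond \<open>k\<close>, powers of \<open>u\<close> beyond the degree of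
    \<open>m\<close>.\<close>
  also have "\<dots> = (\<Sum>j\<le>max k (mdegree m). ?g j)"
    by (intro sum.mono_neutral_left) (auto simp: binomial_eq_0)
  also have "\<dots> = (\<Sum>j\<le>mdegree m. ?g j)"
    using mps_coeff_power_eq_0[OF u0, of m] by (intro sum.mono_neutral_right) auto
  finally show ?thesis
    by (simp add: mps_coeff_q_power[OF assms] u_def poly_sum poly_q_choose)
qed

section \<open>The partition of a monomial\<close>

text \<open>The exponents of the x-variables only; the exponent of z is kept apart because it counts
  singleton blocks.\<close>

definition shape :: "(indet \<Rightarrow>\<^sub>0 nat) \<Rightarrow> nat multiset" where
  "shape m = image_mset (Poly_Mapping.lookup m) (mset_set (Poly_Mapping.keys m - {Zvar}))"

definition shape_part :: "(indet \<Rightarrow>\<^sub>0 nat) \<Rightarrow> nat list" where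
  "shape_part m = rev (sorted_list_of_multiset (shape m))"

lemma mset_shape_part [simp]: "mset (shape_part m) = shape m"
  by (simp add: shape_part_def)

lemma shape_part_partition: "shape_part m \<in> partitions"
proof -
  have "0 \<notin> set_mset (shape m)"
    by (auto simp: shape_def in_keys_iff)
  then have "0 \<notin> set (shape_part m)"
    by (metis mset_shape_part set_mset_mset)
  moreover have "sorted_wrt (\<ge>) (shape_part m)"
    by (simp add: shape_part_def sorted_wrt_rev sorted_sorted_list_of_multiset)
  ultimately show ?thesis by (simp add: partitions_def)
qed

text \<open>Being sorted, a partition is determined by the multiset of its parts. Hence a monomial
  singles out at most one term of each sum over partitions.\<close>

lemma shape_part_unique:
  assumes "\<mu> \<in> partitions" "mset \<mu> = shape m"
  shows "\<mu> = shape_part m"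
proof -
  have "sorted (rev \<mu>)"
    using assms(1) by (simp add: partitions_def sorted_wrt_rev)
  then have "rev \<mu> = sorted_list_of_multiset (shape m)"
    using assms(2) by (metis mset_rev sorted_list_of_multiset_mset sorted_sort_id)
  then show ?thesis by (simp add: shape_part_def rev_swap)
qed

text \<open>Matches the parts of a partition with distinct variables even when parts repeat: each
  entry of \<open>ys\<close> takes a preimage, which is removed from \<open>A\<close>.\<close>

lemma mset_eq_image_mset_set:
  assumes "finite A" "mset ys = image_mset f (mset_set A)"
  obtains xs where "distinct xs" "set xs = A" "map f xs = ys"
  using assms
proof (induction ys arbitrary: A thesis)
  case Nil
  then show ?case by (simp add: mset_set_empty_iff)
next
  case (Cons y ys)
  have "y \<in># image_mset f (mset_set A)"
    using Cons.prems(3) by (metis list.set_intros(1) set_mset_mset)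
  then obtain x where x: "x \<in> A" "f x = y"
    using Cons.prems(2) by auto
  have "mset_set A = add_mset x (mset_set (A - {x}))"
    using x Cons.prems(2) by (simp add: mset_set.remove)
  then have "mset ys = image_mset f (mset_set (A - {x}))"
    using Cons.prems(3) x by simp
  then obtain xs where "distinct xs" "set xs = A - {x}" "map f xs = ys"
    using Cons.IH Cons.prems(2) by blast
  then show ?case
    using x by (intro Cons.prems(1)[of "x # xs"]) auto
qed

section \<open>Vertex types realising a given monomial\<close>

lemma mem_vertices_complete_multipartite:
  "u \<in> fst (complete_multipartite \<mu>) \<longleftrightarrow> fst u < length \<mu> \<and> snd u < \<mu> ! fst u"
  by (cases u) (simp add: complete_multipartite_def)

text \<open>All vertices of block \<open>i\<close> get the type \<open>ts ! i\<close>, so the block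
  contributes that variable to the power of its size.\<close>

lemma type_mono_complete_multipartite:
  assumes "length ts = length \<mu>"
  shows "type_mono (\<lambda>u. ts ! fst u) (fst (complete_multipartite \<mu>)) =
    (\<Sum>i<length \<mu>. Poly_Mapping.single (ts ! i) (\<mu> ! i))"
proof -
  have "(\<Sum>j<n. Poly_Mapping.single v (1::nat)) = Poly_Mapping.single v n" for v :: 'a and n
    by (induction n) (simp_all flip: single_add)
  moreover have "fst (complete_multipartite \<mu>) = Sigma {..<length \<mu>} (\<lambda>i. {..<\<mu> ! i})"
    by (auto simp: complete_multipartite_def)
  moreover have "(\<Sum>u\<in>Sigma {..<length \<mu>} (\<lambda>i. {..<\<mu> ! i}). Poly_Mapping.single (ts ! fst u) (1::nat)) =
      (\<Sum>i<length \<mu>. \<Sum>j<\<mu> ! i. Poly_Mapping.single (ts ! i) 1)"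
    by (subst sum.Sigma) (auto simp: case_prod_unfold)
  ultimately show ?thesis
    by (simp add: type_mono_def)
qed

lemma sum_single_lookup:
  assumes "finite A" "Poly_Mapping.keys m \<subseteq> A"
  shows "(\<Sum>v\<in>A. Poly_Mapping.single v (Poly_Mapping.lookup m v)) = (m :: 'v \<Rightarrow>\<^sub>0 nat)"
proof (rule poly_mapping_eqI)
  fix w
  have "(\<Sum>v\<in>A. Poly_Mapping.lookup m v when v = w) = Poly_Mapping.lookup m w"
    using assms by (auto simp: when_def in_keys_iff)
  then show "Poly_Mapping.lookup (\<Sum>v\<in>A. Poly_Mapping.single v (Poly_Mapping.lookup m v)) w =
      Poly_Mapping.lookup m w"
    by (simp add: lookup_sum lookup_single)
qed

text \<open>The graph attached to \<open>m\<close>: one block for each x-variable, of size its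
  exponent, and one singleton block for each factor z.\<close>

abbreviation multipartite_of :: "(indet \<Rightarrow>\<^sub>0 nat) \<Rightarrow> (nat \<times> nat) graph" where
  "multipartite_of m \<equiv> complete_multipartite (add_ones (Poly_Mapping.lookup m Zvar) (shape_part m))"

text \<open>Each x-block gets its own variable as type and all singleton blocks get z. Two vertices
  thus share a block iff they have the same type, except that different vertices of type z are
  always in different blocks.\<close>

lemma multipartite_of_types:
  fixes m :: "indet \<Rightarrow>\<^sub>0 nat"
  defines "V \<equiv> fst (multipartite_of m)"
  obtains t where "finite V" "type_mono t V = m"
    "\<And>u v. u \<in> V \<Longrightarrow> v \<in> V \<Longrightarrow> fst u = fst v \<longleftrightarrow> (if t u = Zvar then u = v else t u = t v)"
proof -
  let ?n = "Poly_Mapping.lookup m Zvar" and ?\<mu> = "shape_part m"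
  obtain xs where xs: "distinct xs" "set xs = Poly_Mapping.keys m - {Zvar}"
      "map (Poly_Mapping.lookup m) xs = ?\<mu>"
    using mset_eq_image_mset_set[of "Poly_Mapping.keys m - {Zvar}" ?\<mu> "Poly_Mapping.lookup m"]
    by (auto simp: shape_def)
  \<comment> \<open>The types of the blocks, in the order in which \<open>add_ones\<close> lists the
    parts.\<close>
  define ts where "ts = xs @ replicate ?n Zvar"
  have len: "length ?\<mu> = length xs" by (simp flip: xs(3))
  have add: "add_ones ?n ?\<mu> = map (Poly_Mapping.lookup m) xs @ replicate ?n 1"
    by (simp add: add_ones_def xs(3))
  have "(\<Sum>i<length (add_ones ?n ?\<mu>). Poly_Mapping.single (ts ! i) (add_ones ?n ?\<mu> ! i)) =
      (\<Sum>i<length xs. Poly_Mapping.single (ts ! i) (add_ones ?n ?\<mu> ! i)) +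
      (\<Sum>i\<in>{length xs..<length xs + ?n}. Poly_Mapping.single (ts ! i) (add_ones ?n ?\<mu> ! i))"
    unfolding add by (subst sum.union_disjoint[symmetric]) (auto intro!: sum.cong)
  also have "(\<Sum>i<length xs. Poly_Mapping.single (ts ! i) (add_ones ?n ?\<mu> ! i)) =
      (\<Sum>i<length xs. Poly_Mapping.single (xs ! i) (Poly_Mapping.lookup m (xs ! i)))"
    unfolding add ts_def by (intro sum.cong) (auto simp: nth_append)
  also have "\<dots> = (\<Sum>v\<in>Poly_Mapping.keys m - {Zvar}. Poly_Mapping.single v (Poly_Mapping.lookup m v))"
    using xs by (intro sum.reindex_bij_betw bij_betw_nth) auto
  also have "(\<Sum>i\<in>{length xs..<length xs + ?n}. Poly_Mapping.single (ts ! i) (add_ones ?n ?\<mu> ! i)) =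
      (\<Sum>i\<in>{length xs..<length xs + ?n}. Poly_Mapping.single Zvar (1::nat))"
    unfolding add ts_def by (intro sum.cong) (auto simp: nth_append)
  also have "(\<Sum>i\<in>{length xs..<length xs + ?n}. Poly_Mapping.single Zvar (1::nat)) = Poly_Mapping.single Zvar ?n"
    by (intro poly_mapping_eqI) (simp add: lookup_sum lookup_single when_def)
  also have "(\<Sum>v\<in>Poly_Mapping.keys m - {Zvar}. Poly_Mapping.single v (Poly_Mapping.lookup m v)) +
      Poly_Mapping.single Zvar ?n = (\<Sum>v\<in>insert Zvar (Poly_Mapping.keys m). Poly_Mapping.single v (Poly_Mapping.lookup m v))"
    by (subst sum.insert_remove) (auto simp: add.commute)
  also have "\<dots> = m"
    by (intro sum_single_lookup) auto
  finally have mono: "type_mono (\<lambda>u. ts ! fst u) V = m"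
    unfolding V_def by (subst type_mono_complete_multipartite) (auto simp: ts_def add)
  \<comment> \<open>Blocks of type z have size 1, so a vertex in one of them is determined by its
    block number.\<close>
  have ones: "snd u = 0" if "u \<in> V" "ts ! fst u = Zvar" for u
  proof -
    have "fst u < length ts" "snd u < add_ones ?n ?\<mu> ! fst u"
      using that(1) unfolding V_def mem_vertices_complete_multipartite by (simp_all add: add ts_def)
    moreover have "\<not> fst u < length xs"
    proof
      assume "fst u < length xs"
      then have "Zvar \<in> set xs"
        using that(2) nth_mem[of "fst u" xs] by (simp add: ts_def nth_append)
      then show False using xs(2) by blast
    qed
    ultimately show ?thesis
      by (simp add: add nth_append ts_def)
  qed
  show ?thesis
  proof (rule that[OF _ mono])
    show "finite V" by (simp add: V_def finite_complete_multipartite)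
    fix u v assume uv: "u \<in> V" "v \<in> V"
    show "fst u = fst v \<longleftrightarrow> (if ts ! fst u = Zvar then u = v else ts ! fst u = ts ! fst v)"
    proof (cases "ts ! fst u = Zvar")
      case True
      then show ?thesis using ones[of u] ones[of v] uv by (metis prod_eqI)
    next
      case False
      have len: "fst u < length ts" "fst v < length ts"
        using uv unfolding V_def mem_vertices_complete_multipartite by (simp_all add: add ts_def)
      then have u: "fst u < length xs"
        using False by (auto simp: ts_def nth_append split: if_splits)
      show ?thesis
      proof (cases "fst v < length xs")
        case True
        then show ?thesis using u False xs(1) by (simp add: ts_def nth_append nth_eq_iff_index_eq)
      next
        case out: False
        then have "ts ! fst v = Zvar" using len by (simp add: ts_def nth_append)
        then show ?thesis using u out False by auto
      qed
    qed
  qed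
qed

text \<open>This is the product of the two denominators in the identity, so m! clears both.\<close>

lemma mono_fact_shape_part:
  "mono_fact m = fact (Poly_Mapping.lookup m Zvar) * partition_fact (shape_part m)"
proof -
  have "partition_fact (shape_part m) = prod_mset (image_mset fact (mset (shape_part m)))"
    by (simp add: partition_fact_def flip: prod_mset_prod_list)
  also have "\<dots> = (\<Prod>v\<in>Poly_Mapping.keys m - {Zvar}. fact (Poly_Mapping.lookup m v))"
    by (simp add: shape_def image_mset.compositionality comp_def prod_unfold_prod_mset)
  finally show ?thesis
    by (subst mono_fact_superset[of "insert Zvar (Poly_Mapping.keys m)"])
       (auto simp: prod.insert_remove)
qed

text \<open>The hypothesis says that \<open>f\<close> counts sets of a single type with at most one
  vertex of type z. It is demanded only up to the exponent of z in \<open>m\<close>, which covers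
  all subsets of the vertices; so the result also applies to a series without z at monomials without
  z.\<close>

lemma mps_coeff_q_power_chromatic:
  assumes f: "\<And>a. Poly_Mapping.lookup a Zvar \<le> Poly_Mapping.lookup m Zvar \<Longrightarrow>
    of_nat (mono_fact a) * mps_coeff f a =
      (if (\<exists>v. Poly_Mapping.keys a \<subseteq> {v}) \<and> Poly_Mapping.lookup a Zvar \<le> 1 then 1 else 0)"
  shows "of_nat (mono_fact m) * mps_coeff (q_power f) m = chromatic_poly (multipartite_of m)"
proof (rule rat_poly_eqI_nat)
  fix k
  define V where "V = fst (multipartite_of m)"
  obtain t where t: "finite V" "type_mono t V = m"
    "\<And>u v. u \<in> V \<Longrightarrow> v \<in> V \<Longrightarrow> fst u = fst v \<longleftrightarrow> (if t u = Zvar then u = v else t u = t v)"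
    using multipartite_of_types[of m] unfolding V_def by metis
  have f0: "mps_coeff f 0 = 1"
    using f[of 0] by simp
  have egf: "egf_coeff f t S = (if \<forall>u\<in>S. \<forall>v\<in>S. fst u = fst v then 1 else 0)" if S: "S \<subseteq> V" for S
  proof -
    have fin: "finite S" using S t(1) finite_subset by blast
    have card: "card {u \<in> A. t u = Zvar} = Poly_Mapping.lookup (type_mono t A) Zvar" if "finite A" for A
      using that by (simp add: lookup_type_mono)
    have "card {u \<in> S. t u = Zvar} \<le> card {u \<in> V. t u = Zvar}"
      using S t(1) by (intro card_mono) auto
    then have "Poly_Mapping.lookup (type_mono t S) Zvar \<le> Poly_Mapping.lookup m Zvar"
      using fin t by (simp add: card)
    from f[OF this] have "egf_coeff f t S = (if (\<exists>v. t ` S \<subseteq> {v}) \<and> card {u \<in> S. t u = Zvar} \<le> 1 then 1 else 0)"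
      using fin by (simp add: egf_coeff_def keys_type_mono lookup_type_mono)
    \<comment> \<open>The sets counted by \<open>f\<close> are exactly the sets inside one block,
      because types separate blocks except among the vertices of type z.\<close>
    moreover have "(\<exists>v. t ` S \<subseteq> {v}) \<and> card {u \<in> S. t u = Zvar} \<le> 1 \<longleftrightarrow> (\<forall>u\<in>S. \<forall>v\<in>S. fst u = fst v)"
    proof -
      have "card {u \<in> S. t u = Zvar} \<le> 1 \<longleftrightarrow> (\<forall>u\<in>S. \<forall>v\<in>S. t u = Zvar \<longrightarrow> t v = Zvar \<longrightarrow> u = v)"
        using fin card_le_Suc0_iff_eq[of "{u \<in> S. t u = Zvar}"] by auto
      moreover have "(\<exists>v. t ` S \<subseteq> {v}) \<longleftrightarrow> (\<forall>u\<in>S. \<forall>v\<in>S. t u = t v)"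
        by blast
      moreover have "fst u = fst v \<longleftrightarrow> t u = t v \<and> (t u = Zvar \<longrightarrow> t v = Zvar \<longrightarrow> u = v)"
        if "u \<in> S" "v \<in> S" for u v
      proof -
        have "u \<in> V" "v \<in> V" using S that by auto
        then show ?thesis using t(3)[of u v] by auto
      qed
      ultimately show ?thesis by blast
    qed
    ultimately show ?thesis by simp
  qed
  have "of_nat (mono_fact m) * mps_coeff (f ^ k) m = of_nat (card (proper_colorings (multipartite_of m) k))"
    using egf_coeff_power[OF t(1) egf, of k]
    by (simp add: egf_coeff_def t(2)[unfolded V_def] V_def block_colorings_complete_multipartite)
  then have "poly (of_nat (mono_fact m) * mps_coeff (f ^ k) m) (of_nat k) =
      of_nat (card (proper_colorings (multipartite_of m) k))"
    by simp
  then show "poly (of_nat (mono_fact m) * mps_coeff (q_power f) m) (of_nat k) =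
      poly (chromatic_poly (multipartite_of m)) (of_nat k)"
    by (simp add: poly_chromatic_poly_complete_multipartite poly_mps_coeff_q_power[OF f0])
qed

section \<open>Coefficients of both sides\<close>

text \<open>The index \<open>g m\<close> is the only one that can contribute to the coefficient of
  \<open>m\<close>. In the sums below it is the degree, the partition, or the partition with the
  exponent of z.\<close>

lemma infsum_mps_at_most_one_term:
  fixes f :: "'b \<Rightarrow> ('v, 'a::cancel_comm_monoid_add) mps"
  assumes "\<And>a m. a \<in> A \<Longrightarrow> mps_coeff (f a) m \<noteq> 0 \<Longrightarrow> a = g m"
  shows "f summable_on A"
    and "mps_coeff (infsum f A) m = (if g m \<in> A then mps_coeff (f (g m)) m else 0)"
proof -
  have sub: "{a \<in> A. mps_coeff (f a) m \<noteq> 0} \<subseteq> {g m}" for m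
    using assms by blast
  show summable: "f summable_on A"
    unfolding summable_on_mps_iff using sub by (meson finite.emptyI finite_insert finite_subset)
  have "(f has_sum infsum f A) A"
    using summable by simp
  then have "mps_coeff (infsum f A) m = (\<Sum>a\<in>{a \<in> A. mps_coeff (f a) m \<noteq> 0}. mps_coeff (f a) m)"
    by (simp add: has_sum_mps_iff)
  also have "\<dots> = (\<Sum>a\<in>{g m} \<inter> A. mps_coeff (f a) m)"
    using sub[of m] by (intro sum.mono_neutral_left) auto
  finally show "mps_coeff (infsum f A) m = (if g m \<in> A then mps_coeff (f (g m)) m else 0)"
    by (auto simp: Int_insert_left)
qed

lemma mps_coeff_rat_const_mult: "mps_coeff (rat_const r * f) m = smult r (mps_coeff f m)"
  by (simp add: rat_const_def mps_coeff_const_mult)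

section \<open>Power sum series and the base of the q-power\<close>

lemma single_eq_single_iff:
  "n > 0 \<Longrightarrow> Poly_Mapping.single v n = Poly_Mapping.single w k \<longleftrightarrow> v = w \<and> n = (k::nat)"
  by (metis gr_implies_not0 lookup_single_eq lookup_single_not_eq)

lemma power_sum_coeff_neq_0:
  assumes "n \<ge> 1" "mps_coeff (power_sum n) m \<noteq> 0"
  shows "n = mdegree m"
  using assms by (auto simp: mps_coeff_power_sum mdegree_single split: if_splits)

text \<open>Only the term with n the degree of \<open>m\<close> matters, and n! is the factorial of
  the monomial. The free factor \<open>c\<close> serves both the series with q^n and the one
  without.\<close>

lemma mps_coeff_power_sum_series:
  fixes c :: "nat \<Rightarrow> rat poly"
  shows "mps_coeff (\<Sum>\<^sub>\<infinity>n\<in>{1..}. mps_const (c n) * rat_const (1 / fact n) * power_sum n) m =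
    (if \<exists>i n. n \<ge> 1 \<and> m = Poly_Mapping.single (Xvar i) n
     then smult (1 / of_nat (mono_fact m)) (c (mdegree m)) else 0)"
proof -
  let ?f = "\<lambda>n. mps_const (c n) * rat_const (1 / fact n) * power_sum n"
  have coeff: "mps_coeff (?f n) m = c n * smult (1 / fact n) (mps_coeff (power_sum n) m)" for n m
    by (simp add: mult.assoc mps_coeff_const_mult mps_coeff_rat_const_mult)
  have "mps_coeff (infsum ?f {1..}) m = (if mdegree m \<in> {1..} then mps_coeff (?f (mdegree m)) m else 0)"
    by (rule infsum_mps_at_most_one_term(2)) (auto simp: coeff dest!: power_sum_coeff_neq_0[rotated])
  also have "\<dots> = (if \<exists>i n. n \<ge> 1 \<and> m = Poly_Mapping.single (Xvar i) n
     then smult (1 / of_nat (mono_fact m)) (c (mdegree m)) else 0)"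
    by (auto simp: coeff mps_coeff_power_sum mdegree_single)
  finally show ?thesis .
qed

lemma mps_coeff_exp_series:
  "mps_coeff (\<Sum>\<^sub>\<infinity>n\<in>{1..}. rat_const (1 / fact n) * power_sum n) m =
    (if \<exists>i n. n \<ge> 1 \<and> m = Poly_Mapping.single (Xvar i) n then [:1 / of_nat (mono_fact m):] else 0)"
proof -
  have "mps_const 1 = (1 :: series)"
    by (intro mps_eqI) (simp add: mps_const_def mps_coeff_1)
  moreover have "smult r 1 = [:r:]" for r :: rat
    by (simp add: one_pCons)
  ultimately show ?thesis
    using mps_coeff_power_sum_series[of "\<lambda>_. 1" m] by (simp only: mult_1)
qed

lemma mps_coeff_zz_power: "mps_coeff (zz ^ n) m = (if m = Poly_Mapping.single Zvar n then 1 else 0)"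
  by (simp add: zz_def mps_coeff_var_power)

lemma keys_subset_singletonE:
  assumes "Poly_Mapping.keys a \<subseteq> {v}"
  obtains n where "a = Poly_Mapping.single v (n :: nat)"
proof
  show "a = Poly_Mapping.single v (Poly_Mapping.lookup a v)"
    using assms by (intro poly_mapping_eqI) (auto simp: lookup_single when_def in_keys_iff)
qed

text \<open>The monomials in at most one variable, with z at most to the first power, are 1, z and
  the powers of the x-variables; they come from the three summands in turn, with weights 1, 1 and 1
  / n!.\<close>

lemma mps_coeff_generating_base:
  "of_nat (mono_fact a) *
      mps_coeff (1 + zz + (\<Sum>\<^sub>\<infinity>n\<in>{1..}. rat_const (1 / fact n) * power_sum n)) a =
    (if (\<exists>v. Poly_Mapping.keys a \<subseteq> {v}) \<and> Poly_Mapping.lookup a Zvar \<le> 1 then 1 else 0)"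
proof -
  define P where "P = (\<Sum>\<^sub>\<infinity>n\<in>{1..}. rat_const (1 / fact n) * power_sum n)"
  have P: "mps_coeff P m = (if \<exists>i n. n \<ge> 1 \<and> m = Poly_Mapping.single (Xvar i) n
      then [:1 / of_nat (mono_fact m):] else 0)" for m
    unfolding P_def by (rule mps_coeff_exp_series)
  have zz: "mps_coeff zz m = (if m = Poly_Mapping.single Zvar 1 then 1 else 0)" for m
    using mps_coeff_zz_power[of 1] by simp
  have "of_nat (mono_fact a) * mps_coeff (1 + zz + P) a =
      (if (\<exists>v. Poly_Mapping.keys a \<subseteq> {v}) \<and> Poly_Mapping.lookup a Zvar \<le> 1 then 1 else 0)"
  proof (cases "\<exists>v. Poly_Mapping.keys a \<subseteq> {v}")
    case False
    have single: "a \<noteq> Poly_Mapping.single v n" for v n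
    proof
      assume "a = Poly_Mapping.single v n"
      then have "Poly_Mapping.keys a \<subseteq> {v}" by simp
      then show False using False by blast
    qed
    have "a \<noteq> 0" using single[of undefined 0] by simp
    then show ?thesis
      using False single by (simp add: mps_coeff_1 zz P)
  next
    case True
    then obtain v n where a: "a = Poly_Mapping.single v n"
      using keys_subset_singletonE by metis
    show ?thesis
    proof (cases "n = 0")
      case True
      have "a = 0" using True by (simp add: a)
      moreover have "Poly_Mapping.single v n \<noteq> 0" "0 \<noteq> Poly_Mapping.single v n" if "n > 0" for v :: indet and n :: nat
        using that by (metis gr_implies_not0 lookup_single_eq lookup_zero)+
      ultimately show ?thesis
        by (auto simp: mps_coeff_1 zz P Suc_le_eq)
    next
      case False
      then have "n > 0" by simp
      have "a \<noteq> 0" using False by (metis a lookup_single_eq lookup_zero)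
      show ?thesis
      proof (cases v)
        case Zvar
        then show ?thesis using \<open>a \<noteq> 0\<close> \<open>n > 0\<close>
          by (auto simp: mps_coeff_1 zz P a single_eq_single_iff le_Suc_eq)
      next
        case (Xvar i)
        then show ?thesis using \<open>a \<noteq> 0\<close> \<open>n > 0\<close>
          by (auto simp: mps_coeff_1 zz P a single_eq_single_iff Suc_le_eq
              lookup_single of_nat_poly one_pCons)
      qed
    qed
  qed
  then show ?thesis
    unfolding P_def .
qed


text \<open>If \<open>v\<close> does not occur in \<open>f\<close>, it occurs in no natural power of
  \<open>f\<close>, hence by evaluation not in the q-power. It is applied to the series without
  z.\<close>

lemma mps_coeff_q_power_eq_0:
  assumes "mps_coeff f 0 = 1" "\<And>a. Poly_Mapping.lookup a v > 0 \<Longrightarrow> mps_coeff f a = 0"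
    and "Poly_Mapping.lookup m v > 0"
  shows "mps_coeff (q_power f) m = 0"
proof (rule rat_poly_eqI_nat)
  have "mps_coeff (f ^ k) m = 0" for k
    using assms(3)
  proof (induction k arbitrary: m)
    case 0
    then show ?case by (auto simp: mps_coeff_1)
  next
    case (Suc k)
    have "mps_coeff f a * mps_coeff (f ^ k) b = 0" if "(a, b) \<in> monomial_splits m" for a b
    proof -
      have "Poly_Mapping.lookup a v + Poly_Mapping.lookup b v > 0"
        using that Suc.prems by (auto simp: monomial_splits_def lookup_add)
      then show ?thesis using assms(2) Suc.IH by auto
    qed
    then show ?case
      by (auto simp: mps_coeff_mult intro!: sum.neutral)
  qed
  then show "poly (mps_coeff (q_power f) m) (of_nat k) = poly 0 (of_nat k)" for k
    by (simp add: poly_mps_coeff_q_power[OF assms(1)])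
qed

section \<open>The sums over partitions\<close>

text \<open>The second factor of a contributing split must be z^n, and the first must be free of z;
  so n is the full exponent of z in \<open>m\<close>.\<close>

lemma mps_coeff_monomial_sym_zz_power:
  "mps_coeff (monomial_sym \<mu> * zz ^ n) m =
    (if Poly_Mapping.lookup m Zvar = n \<and> shape m = mset \<mu> then 1 else 0)"
proof -
  let ?z = "Poly_Mapping.single Zvar n"
  let ?Q = "Poly_Mapping.lookup m Zvar = n \<and> shape m = mset \<mu>"
  have X: "Poly_Mapping.keys a \<subseteq> range Xvar \<longleftrightarrow> Zvar \<notin> Poly_Mapping.keys a" for a :: "indet \<Rightarrow>\<^sub>0 nat"
    by (auto, metis indet.exhaust rangeI)
  have coeff: "mps_coeff (monomial_sym \<mu>) a * mps_coeff (zz ^ n) b =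
      (if (a, b) = (m - ?z, ?z) then (if ?Q then 1 else 0) else 0)" if ab: "(a, b) \<in> monomial_splits m" for a b
  proof (cases "b = ?z")
    case False
    then show ?thesis by (simp add: mps_coeff_zz_power)
  next
    case True
    then have m: "m = a + ?z" using ab by (simp add: monomial_splits_def)
    have lookup: "Poly_Mapping.lookup m v = Poly_Mapping.lookup a v" if "v \<noteq> Zvar" for v
      using that by (simp add: m lookup_add lookup_single when_def)
    have keys: "Poly_Mapping.keys m - {Zvar} = Poly_Mapping.keys a - {Zvar}"
      using lookup by (auto simp: in_keys_iff)
    have shape: "shape m = shape a"
      unfolding shape_def keys by (intro image_mset_cong) (auto simp: lookup)
    have "Zvar \<notin> Poly_Mapping.keys a \<longleftrightarrow> Poly_Mapping.lookup m Zvar = n"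
      by (simp add: m lookup_add in_keys_iff)
    moreover have "Poly_Mapping.keys a - {Zvar} = Poly_Mapping.keys a" if "Zvar \<notin> Poly_Mapping.keys a"
      using that by simp
    ultimately have "mps_coeff (monomial_sym \<mu>) a = (if ?Q then 1 else 0)"
      by (auto simp: monomial_sym_def X shape shape_def[of a])
    then show ?thesis using True m by (simp add: mps_coeff_zz_power)
  qed
  have "mps_coeff (monomial_sym \<mu> * zz ^ n) m =
      (\<Sum>p\<in>monomial_splits m. if p = (m - ?z, ?z) then (if ?Q then 1 else 0) else 0)"
    unfolding mps_coeff_mult 
  proof (intro sum.cong refl)
    fix p assume "p \<in> monomial_splits m"
    then show "(case p of (a, b) \<Rightarrow> mps_coeff (monomial_sym \<mu>) a * mps_coeff (zz ^ n) b) =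
        (if p = (m - ?z, ?z) then (if ?Q then 1 else 0) else 0)"
      using coeff[of "fst p" "snd p"] by (cases p) (simp only: prod.case fst_conv snd_conv)
  qed
  also have "\<dots> = (if (m - ?z, ?z) \<in> monomial_splits m then (if ?Q then 1 else 0) else 0)"
    by (subst sum.delta) auto
  also have "\<dots> = (if ?Q then 1 else 0)"
  proof -
    \<comment> \<open>Subtraction of exponents truncates, so this needs z to occur at least n
      times.\<close>
    have "m - ?z + ?z = m" if "Poly_Mapping.lookup m Zvar = n"
      using that by (intro poly_mapping_eqI) (auto simp: lookup_add lookup_minus lookup_single when_def)
    then show ?thesis by (auto simp: monomial_splits_def)
  qed
  finally show ?thesis .
qed

lemma mps_coeff_partition_term_zz:
  "mps_coeff (mps_const c * rat_const r * monomial_sym \<mu> * rat_const s * zz ^ n) m =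
    (if Poly_Mapping.lookup m Zvar = n \<and> shape m = mset \<mu> then smult (r * s) c else 0)"
proof -
  have eq: "mps_const c * rat_const r * monomial_sym \<mu> * rat_const s * zz ^ n =
      mps_const c * (rat_const r * (rat_const s * (monomial_sym \<mu> * zz ^ n)))"
    by (simp only: mult_ac)
  show ?thesis
    unfolding eq by (simp add: mps_coeff_const_mult mps_coeff_rat_const_mult mps_coeff_monomial_sym_zz_power)
qed

lemma mps_coeff_partition_term:
  "mps_coeff (mps_const c * rat_const r * monomial_sym \<mu>) m =
    (if Poly_Mapping.lookup m Zvar = 0 \<and> shape m = mset \<mu> then smult r c else 0)"
  using mps_coeff_partition_term_zz[of c r \<mu> 1 0 m] mps_coeff_rat_const_mult
  by (simp add: rat_const_def mps_coeff_monomial_sym_zz_power[of \<mu> 0, simplified] mps_coeff_const_mult mult.assoc)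

text \<open>The set \<open>A\<close> is arbitrary in order to treat all partitions and those with at
  least two parts together. Without z no singleton blocks are added, and the factorial of the
  partition is that of the monomial.\<close>

lemma partition_series:
  assumes "A \<subseteq> partitions"
  defines "t \<equiv> \<lambda>\<mu>. mps_const (chromatic_poly (complete_multipartite \<mu>)) *
        rat_const (1 / of_nat (partition_fact \<mu>)) * monomial_sym \<mu>"
  shows "t summable_on A"
    and "mps_coeff (infsum t A) m = (if Poly_Mapping.lookup m Zvar = 0 \<and> shape_part m \<in> A
      then smult (1 / of_nat (mono_fact m)) (chromatic_poly (multipartite_of m)) else 0)"
proof -
  have one: "\<mu> = shape_part m" if "\<mu> \<in> A" "mps_coeff (t \<mu>) m \<noteq> 0" for \<mu> m
    using that assms(1) by (intro shape_part_unique) (auto simp: t_def mps_coeff_partition_term split: if_splits)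
  show "t summable_on A"
    by (rule infsum_mps_at_most_one_term(1)[OF one])
  show "mps_coeff (infsum t A) m = (if Poly_Mapping.lookup m Zvar = 0 \<and> shape_part m \<in> A
      then smult (1 / of_nat (mono_fact m)) (chromatic_poly (multipartite_of m)) else 0)"
    by (subst infsum_mps_at_most_one_term(2)[OF one])
       (auto simp: t_def mps_coeff_partition_term mono_fact_shape_part add_ones_def)
qed

text \<open>Both indices can be read off from \<open>m\<close>: n is its exponent of z, and \<mu>
  comes from its x-part.\<close>

lemma marked_partition_series:
  defines "t \<equiv> \<lambda>(n, \<mu>). mps_const (chromatic_poly (complete_multipartite (add_ones n \<mu>))) *
        rat_const (1 / of_nat (partition_fact \<mu>)) * monomial_sym \<mu> * rat_const (1 / fact n) * zz ^ n"
  shows "t summable_on {1..} \<times> partitions"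
    and "mps_coeff (infsum t ({1..} \<times> partitions)) m = (if Poly_Mapping.lookup m Zvar \<ge> 1
      then smult (1 / of_nat (mono_fact m)) (chromatic_poly (multipartite_of m)) else 0)"
proof -
  define g where "g m = (Poly_Mapping.lookup m Zvar, shape_part m)" for m
  have one: "p = g m" if "p \<in> {1..} \<times> partitions" "mps_coeff (t p) m \<noteq> 0" for p m
  proof -
    obtain n \<mu> where p: "p = (n, \<mu>)" by (cases p)
    then have "Poly_Mapping.lookup m Zvar = n" "mset \<mu> = shape m"
      using that(2) by (simp_all add: t_def mps_coeff_partition_term_zz split: if_splits)
    moreover have "\<mu> \<in> partitions" using that(1) p by simp
    ultimately show ?thesis using p shape_part_unique by (simp add: g_def)
  qed
  show "t summable_on {1..} \<times> partitions"
    by (rule infsum_mps_at_most_one_term(1)[OF one])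
  show "mps_coeff (infsum t ({1..} \<times> partitions)) m = (if Poly_Mapping.lookup m Zvar \<ge> 1
      then smult (1 / of_nat (mono_fact m)) (chromatic_poly (multipartite_of m)) else 0)"
    by (subst infsum_mps_at_most_one_term(2)[OF one])
       (auto simp: g_def t_def mps_coeff_partition_term_zz mono_fact_shape_part shape_part_partition mult.commute[of "fact _" "of_nat _"])
qed

section \<open>The exceptional monomials\<close>

text \<open>There are no edges, so all k^n maps are proper. This explains the factor q^n in the
  subtracted power sums.\<close>

lemma chromatic_poly_single_block: "chromatic_poly (complete_multipartite [n]) = qq ^ n"
proof (rule rat_poly_eqI_nat)
  fix k
  let ?V = "fst (complete_multipartite [n])"
  have V: "?V = Pair 0 ` {..<n}"
    by (auto simp: complete_multipartite_def)
  have "proper_colorings (complete_multipartite [n]) k = ?V \<rightarrow>\<^sub>E {..<k}"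
    by (auto simp: proper_colorings_def complete_multipartite_def)
  moreover have "card (?V \<rightarrow>\<^sub>E {..<k}) = k ^ n"
    by (simp add: card_PiE V card_image inj_on_def prod.reindex)
  ultimately show "poly (chromatic_poly (complete_multipartite [n])) (of_nat k) = poly (qq ^ n) (of_nat k)"
    by (simp add: poly_chromatic_poly_complete_multipartite)
qed

lemma smult_inverse_of_nat_mult:
  fixes c :: "rat poly"
  assumes "of_nat n * c = d" "n > 0"
  shows "c = smult (1 / of_nat n) d"
  using assms by (auto simp: of_nat_poly)

text \<open>The number of parts is the number of x-variables in \<open>m\<close>. These monomials
  are missing from the left-hand side of the first identity and are the ones subtracted on its
  right-hand side.\<close>

lemma shape_part_short:
  assumes "Poly_Mapping.lookup m Zvar = 0" "length (shape_part m) < 2"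
  shows "m = 0 \<or> (\<exists>i n. n \<ge> 1 \<and> m = Poly_Mapping.single (Xvar i) n)"
proof -
  have keys: "Poly_Mapping.keys m - {Zvar} = Poly_Mapping.keys m"
    using assms(1) by (auto simp: in_keys_iff)
  have "length (shape_part m) = size (shape m)"
    by (metis mset_shape_part size_mset)
  then have "card (Poly_Mapping.keys m) = length (shape_part m)"
    by (simp add: shape_def keys)
  then consider "card (Poly_Mapping.keys m) = 0" | "card (Poly_Mapping.keys m) = 1"
    using assms(2) by linarith
  then show ?thesis
  proof cases
    case 1
    then show ?thesis by simp
  next
    case 2
    then obtain v where v: "Poly_Mapping.keys m = {v}" by (auto simp: card_1_singleton_iff)
    then obtain n where n: "m = Poly_Mapping.single v n"
      using keys_subset_singletonE[of m v] by auto
    have "v \<noteq> Zvar" using v assms(1) by (metis in_keys_iff singletonI)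
    then obtain i where "v = Xvar i" by (cases v) auto
    moreover have "n \<ge> 1" using v n by (cases n) auto
    ultimately show ?thesis using n by blast
  qed
qed

lemma shape_part_0 [simp]: "shape_part 0 = []"
  by (simp add: shape_part_def shape_def)

lemma shape_part_single: "n \<ge> 1 \<Longrightarrow> shape_part (Poly_Mapping.single (Xvar i) n) = [n]"
  by (simp add: shape_part_def shape_def)

theorem corollary2p3p8:
  shows
   "((\<lambda>\<mu>. mps_const (chromatic_poly (complete_multipartite \<mu>)) *
        rat_const (1 / of_nat (partition_fact \<mu>)) * monomial_sym \<mu>)
      summable_on {\<mu> \<in> partitions. length \<mu> \<ge> 2}) \<and>
    ((\<lambda>(n, \<mu>). mps_const (chromatic_poly (complete_multipartite (add_ones n \<mu>))) *
        rat_const (1 / of_nat (partition_fact \<mu>)) * monomial_sym \<mu> *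
        rat_const (1 / fact n) * zz ^ n)
      summable_on {1..} \<times> partitions) \<and>
    (\<Sum>\<^sub>\<infinity>\<mu>\<in>{\<mu> \<in> partitions. length \<mu> \<ge> 2}.
        mps_const (chromatic_poly (complete_multipartite \<mu>)) *
        rat_const (1 / of_nat (partition_fact \<mu>)) * monomial_sym \<mu>) +
    (\<Sum>\<^sub>\<infinity>(n, \<mu>)\<in>{1..} \<times> partitions.
        mps_const (chromatic_poly (complete_multipartite (add_ones n \<mu>))) *
        rat_const (1 / of_nat (partition_fact \<mu>)) * monomial_sym \<mu> *
        rat_const (1 / fact n) * zz ^ n)
    = q_power (1 + zz + (\<Sum>\<^sub>\<infinity>n\<in>{1..}. rat_const (1 / fact n) * power_sum n))
      - 1 - (\<Sum>\<^sub>\<infinity>n\<in>{1..}. mps_const (qq ^ n) * rat_const (1 / fact n) * power_sum n) \<and>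
    ((\<lambda>\<mu>. mps_const (chromatic_poly (complete_multipartite \<mu>)) *
        rat_const (1 / of_nat (partition_fact \<mu>)) * monomial_sym \<mu>)
      summable_on partitions) \<and>
    (\<Sum>\<^sub>\<infinity>\<mu>\<in>partitions.
        mps_const (chromatic_poly (complete_multipartite \<mu>)) *
        rat_const (1 / of_nat (partition_fact \<mu>)) * monomial_sym \<mu>)
    = q_power (1 + (\<Sum>\<^sub>\<infinity>n\<in>{1..}. rat_const (1 / fact n) * power_sum n))"
  (is "?sum2 \<and> ?sumz \<and> ?S2 + ?Sz = q_power ?f - 1 - ?Q \<and> ?sum \<and> ?S = q_power ?g")
proof (intro conjI)
  \<comment> \<open>The coefficient of \<open>m\<close> in the q-power of \<open>?f\<close>; each
    sum over partitions has this coefficient on some monomials and 0 on the others.\<close>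
  define d where "d m = smult (1 / of_nat (mono_fact m)) (chromatic_poly (multipartite_of m))" for m
  show ?sum2 by (rule partition_series(1)) simp
  show ?sum by (rule partition_series(1)) simp
  show ?sumz by (rule marked_partition_series(1))
  have f: "mps_coeff (q_power ?f) m = d m" for m
    unfolding d_def by (rule smult_inverse_of_nat_mult[OF mps_coeff_q_power_chromatic mono_fact_pos])
      (rule mps_coeff_generating_base)
  have fg: "mps_coeff ?g a = mps_coeff ?f a" if "Poly_Mapping.lookup a Zvar = 0" for a
    using that mps_coeff_zz_power[of 1 a] by (auto simp: lookup_single)
  \<comment> \<open>On monomials without z the two bases agree and the counting argument applies
    again; all other coefficients vanish as \<open>?g\<close> is free of z.\<close>
  have g: "mps_coeff (q_power ?g) m = (if Poly_Mapping.lookup m Zvar = 0 then d m else 0)" for m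
  proof (cases "Poly_Mapping.lookup m Zvar = 0")
    case True
    have "mps_coeff (q_power ?g) m = d m"
      unfolding d_def
    proof (rule smult_inverse_of_nat_mult[OF mps_coeff_q_power_chromatic mono_fact_pos])
      fix a :: "indet \<Rightarrow>\<^sub>0 nat"
      assume "Poly_Mapping.lookup a Zvar \<le> Poly_Mapping.lookup m Zvar"
      then have a: "Poly_Mapping.lookup a Zvar = 0"
        using True by simp
      show "of_nat (mono_fact a) * mps_coeff ?g a =
          (if (\<exists>v. Poly_Mapping.keys a \<subseteq> {v}) \<and> Poly_Mapping.lookup a Zvar \<le> 1 then 1 else 0)"
        unfolding fg[OF a] by (rule mps_coeff_generating_base)
    qed
    then show ?thesis using True by simp
  next
    case False
    have "mps_coeff (q_power ?g) m = 0"
    proof (rule mps_coeff_q_power_eq_0[where v = Zvar])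
      show "mps_coeff ?g 0 = 1"
        using fg[of 0] mps_coeff_generating_base[of 0] by simp
      show "mps_coeff ?g a = 0" if "Poly_Mapping.lookup a Zvar > 0" for a
        using that by (auto simp: mps_coeff_1 mps_coeff_exp_series[unfolded One_nat_def] lookup_single)
    qed (use False in simp)
    then show ?thesis using False by simp
  qed
  show "?S = q_power ?g"
  proof (rule mps_eqI)
    fix m
    show "mps_coeff ?S m = mps_coeff (q_power ?g) m"
      unfolding g by (subst partition_series(2)) (auto simp: d_def shape_part_partition add_ones_def)
  qed
  show "?S2 + ?Sz = q_power ?f - 1 - ?Q"
  proof (rule mps_eqI)
    fix m
    have S2: "mps_coeff ?S2 m =
        (if Poly_Mapping.lookup m Zvar = 0 \<and> length (shape_part m) \<ge> 2 then d m else 0)"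
      by (subst partition_series(2)) (auto simp: d_def shape_part_partition)
    have Sz: "mps_coeff ?Sz m = (if Poly_Mapping.lookup m Zvar \<ge> 1 then d m else 0)"
      unfolding d_def by (rule marked_partition_series(2))
    have Q: "mps_coeff ?Q m = (if \<exists>i n. n \<ge> 1 \<and> m = Poly_Mapping.single (Xvar i) n
       then smult (1 / of_nat (mono_fact m)) (qq ^ mdegree m) else 0)"
      by (rule mps_coeff_power_sum_series)
    \<comment> \<open>The first two cases are the terms removed by the subtractions; every other
      monomial belongs to exactly one of the two sums on the left.\<close>
    consider "m = 0" | i n where "n \<ge> 1" "m = Poly_Mapping.single (Xvar i) n"
      | "m \<noteq> 0" "\<nexists>i n. n \<ge> 1 \<and> m = Poly_Mapping.single (Xvar i) n"
      by blast
    then show "mps_coeff (?S2 + ?Sz) m = mps_coeff (q_power ?f - 1 - ?Q) m"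
    proof cases
      case 1
      then have "\<nexists>i n. n \<ge> 1 \<and> m = Poly_Mapping.single (Xvar i) n"
        by (metis lookup_single_eq lookup_zero not_one_le_zero)
      moreover have "d m = 1"
        using 1 by (simp add: d_def add_ones_def chromatic_poly_empty)
      ultimately show ?thesis
        using 1 unfolding mps_coeff_add mps_coeff_diff f S2 Sz Q by (simp add: mps_coeff_1)
    next
      case 2
      \<comment> \<open>The graph is a single block of n vertices. Neither sum on the left reaches
        this monomial, so the q-power and the power sum series must cancel.\<close>
      then have "d m = smult (1 / of_nat (mono_fact m)) (qq ^ mdegree m)"
        by (simp add: d_def add_ones_def chromatic_poly_single_block shape_part_single mdegree_single lookup_single)
      moreover have "m \<noteq> 0"
        using 2 by (metis lookup_single_eq lookup_zero not_one_le_zero)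
      moreover have "mps_coeff ?Q m = smult (1 / of_nat (mono_fact m)) (qq ^ mdegree m)"
        unfolding Q using 2 by auto
      ultimately show ?thesis
        using 2 unfolding mps_coeff_add mps_coeff_diff f S2 Sz
        by (simp add: mps_coeff_1 shape_part_single lookup_single)
    next
      case 3
      then have "Poly_Mapping.lookup m Zvar \<ge> 1 \<or> length (shape_part m) \<ge> 2"
        using shape_part_short[of m] by (metis less_one not_le)
      then show ?thesis
        using 3 unfolding mps_coeff_add mps_coeff_diff f S2 Sz Q by (auto simp: mps_coeff_1)
    qed
  qed
qed

end
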